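(* Let $J\ge3$, let $G$ be a subgroup of $D_J$, and let $(S,\{f_s\}_{s\in S},G)$ be a $(J,G)$-s.s. system with associated self-similar set $K$. Then the following hold: (C2) For any $i\in\mathbb{Z}_J$, $K\cap b_i\neq\emptyset$. (C3) For any $g\in G_*$ and $w\in T$, $g(K_w)=K_{g_*(w)}$. (C4) If $w,v\in T_n$ for some $n\ge1$ and $Q_w\cap Q_v=b_i(w)=b_j(v)$ for some $i,j\in\mathbb{Z}_J$, then $K_w\cap K_v\neq\emptyset$, and $R_{w,v}(K_{wu})=K_{vg_*(u)}$ for any $u\in T$, where $R_{w,v}$ is the reflection in the line containing $b_i(w)$ and $g=(f_v)^{-1}\circ R_{w,v}\circ f_w\in G$. (C5) $K$ is connected.
   Context: Polygon: $J\ge3$ is an integer, $\mathbb{Z}_J=\mathbb{Z}/J\mathbb{Z}$, $p_i=\frac1{\cos(\pi/J)}(\cos\theta_i,\sin\theta_i)$ with $\theta_i=\frac{\pi}{J}+\frac{2\pi}{J}i-\frac{\pi}{2}$, $b_i$ is the segment joining $p_{i-1}$ and $p_i$, and $Q_*\subset\mathbb{R}^2$ is the closed filled regular $J$-gon with vertices $p_0,\dots,p_{J-1}$. $R_\theta$ is the reflection in the line through $0$ with direction $(\cos\theta,\sin\theta)$; $D_J=\{g\in O(2): g(Q_* )=Q_*\}$; $\rho(i)=2\pi i/J$; $D_J^*$ is the subgroup of $O(2)$ generated by $D_J$ and all $R_{\rho(i)}$. System: For a subgroup $G$ of $D_J$, a finite set $S$ and contractions $\{f_s\}_{s\in S}$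 of $\mathbb{R}^2$, $(S,\{f_s\}_{s\in S},G)$ is a $G$-symmetric $J$-gon-based self-similar system ($(J,G)$-s.s. system) if: (A1) there are $r\in(0,1)$ and $(\varphi_s,c_s)\in D_J^*\times\mathbb{R}^2$ with $f_s(x)=r\varphi_s(x)+c_s$ for all $x$, and $f_s(Q_* )\subseteq Q_*$ for all $s\in S$; (A2) for every $i\in\mathbb{Z}_J$ there is $(s,j)\in S\times\mathbb{Z}_J$ with $f_s(b_j)\subseteq b_i$; (A3) for every $g\in G$ there is $g_*:S\to S$ with $(f_{g_*(s)})^{-1}\circ g\circ f_s\in G$ for all $s\in S$; (A4) if $s\neq s'$ and $f_s(Q_* )\cap f_{s'}(Q_* )\neq\emptyset$, then either (a) $f_s(Q_* )\cap f_{s'}(Q_* )=f_s(b_i)=f_{s'}(b_j)$ for some $i,j$ and $(\varphi_{s'})^{-1}\circ\varphi_s\circ R_{\rho(i)}\in G$, or (b) $f_s(Q_* )\cap f_{s'}(Q_* )=\{f_s(p_i)\}=\{f_{s'}(p_j)\}$ for some $i,j$; (A5) the graph $(S,E_1^\ell)$, $E_1^\ell=\{(s,s'): \text{(A4)(a) holds}\}$, is connected. Words and $K$: $K$ is the unique nonempty compact set with $K=\bigcup_{s\in S}f_s(K)$. $T_m=S^m$, $T_0=\{\phi\}$ (empty word, $f_\phi=\mathrm{id}$), $T=\bigcup_{m\ge0}T_m$, $|w|=m$ for $w\in T_m$; $f_{w_1\dots w_m}=f_{w_1}\circ\dots\circ f_{w_m}$, $K_w=f_w(K)$, $Q_w=f_w(Q_*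 )$, $b_i(w)=f_w(b_i)$. Symmetries: $G_*$ is the set of $g\in D_J$ such that for every $w\in T$ there is $v\in T$ with $|v|=|w|$ and $g(Q_w)=Q_v$; for $g\in G_*$, $g_*(w)$ denotes this $v$, which is unique. One has $G\subseteq G_*$, so $g_*:T\to T$ is defined for $g\in G$. *)

theory Defs
  imports "HOL-Analysis.Analysis" "HOL-Algebra.Generated_Groups"
begin

text \<open>
  Indices in $Z/JZ$ are represented by integers: \<open>vertex J i\<close>, \<open>edge J i\<close> and
  \<open>reflect_dir (rho J i)\<close> only depend on \<open>i\<close> modulo \<open>J\<close> (see \<open>vertex_periodic\<close> etc. below),
  so quantifying over \<open>i :: int\<close> is quantifying over $Z/JZ$.
\<close>

definition dir :: "real \<Rightarrow> real^2" where
  "dir t = vector [cos t, sin t]"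

definition theta :: "nat \<Rightarrow> int \<Rightarrow> real" where
  "theta J i = pi / real J + 2 * pi / real J * of_int i - pi / 2"

definition vertex :: "nat \<Rightarrow> int \<Rightarrow> real^2" where
  "vertex J i = (1 / cos (pi / real J)) *\<^sub>R dir (theta J i)"

definition edge :: "nat \<Rightarrow> int \<Rightarrow> (real^2) set" where
  "edge J i = closed_segment (vertex J (i - 1)) (vertex J i)"

definition polygon :: "nat \<Rightarrow> (real^2) set" where
  "polygon J = convex hull (vertex J ` {0..int J - 1})"

text \<open>
  Reflection in a line \<open>L\<close> (a set): the orthogonal projection \<open>closest_point L x\<close> is the midpoint
  of \<open>x\<close> and its image.
\<close>

definition reflect_in :: "(real^2) set \<Rightarrow> real^2 \<Rightarrow> real^2" where
  "reflect_in L x = 2 *\<^sub>R closest_point L x - x"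

definition reflect_dir :: "real \<Rightarrow> real^2 \<Rightarrow> real^2" where
  "reflect_dir t = reflect_in (span {dir t})"

definition rho :: "nat \<Rightarrow> int \<Rightarrow> real" where
  "rho J i = 2 * pi * of_int i / real J"

definition O2 :: "(real^2 \<Rightarrow> real^2) monoid" where
  "O2 = \<lparr>carrier = {g. orthogonal_transformation g}, mult = (\<circ>), one = id\<rparr>"

definition D_set :: "nat \<Rightarrow> (real^2 \<Rightarrow> real^2) set" where
  "D_set J = {g. orthogonal_transformation g \<and> g ` polygon J = polygon J}"

definition D_group :: "nat \<Rightarrow> (real^2 \<Rightarrow> real^2) monoid" where
  "D_group J = O2\<lparr>carrier := D_set J\<rparr>"

definition D_ext :: "nat \<Rightarrow> (real^2 \<Rightarrow> real^2) set" where
  "D_ext J = generate O2 (D_set J \<union> range (\<lambda>i. reflect_dir (rho J i)))"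

lemma dir_shift: "dir (t + 2 * pi) = dir t"
  by (simp add: dir_def)

lemma vertex_periodic:
  assumes "J \<noteq> 0" shows "vertex J (i + int J) = vertex J i"
proof -
  have "theta J (i + int J) = theta J i + 2 * pi"
    using assms by (simp add: theta_def field_simps)
  then show ?thesis by (simp add: vertex_def dir_shift)
qed

lemma edge_periodic:
  assumes "J \<noteq> 0" shows "edge J (i + int J) = edge J i"
  using vertex_periodic[OF assms, of i] vertex_periodic[OF assms, of "i - 1"]
  by (simp add: edge_def algebra_simps)

lemma reflect_dir_rho_periodic:
  assumes "J \<noteq> 0" shows "reflect_dir (rho J (i + int J)) = reflect_dir (rho J i)"
proof -
  have "rho J (i + int J) = rho J i + 2 * pi"
    using assms by (simp add: rho_def field_simps)
  then show ?thesis by (simp add: reflect_dir_def dir_shift)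
qed

definition meet_at_edge ::
  "nat \<Rightarrow> (real^2 \<Rightarrow> real^2) set \<Rightarrow> ('s \<Rightarrow> real^2 \<Rightarrow> real^2) \<Rightarrow> ('s \<Rightarrow> real^2 \<Rightarrow> real^2) \<Rightarrow>
    's \<Rightarrow> 's \<Rightarrow> bool" where
  "meet_at_edge J G f \<phi> s s' \<longleftrightarrow>
    (\<exists>i j. f s ` polygon J \<inter> f s' ` polygon J = f s ` edge J i \<and>
           f s ` edge J i = f s' ` edge J j \<and>
           Hilbert_Choice.inv (\<phi> s') \<circ> \<phi> s \<circ> reflect_dir (rho J i) \<in> G)"

definition meet_at_vertex ::
  "nat \<Rightarrow> ('s \<Rightarrow> real^2 \<Rightarrow> real^2) \<Rightarrow> 's \<Rightarrow> 's \<Rightarrow> bool" where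
  "meet_at_vertex J f s s' \<longleftrightarrow>
    (\<exists>i j. f s ` polygon J \<inter> f s' ` polygon J = {f s (vertex J i)} \<and>
           f s (vertex J i) = f s' (vertex J j))"

definition edge_adjacency ::
  "nat \<Rightarrow> (real^2 \<Rightarrow> real^2) set \<Rightarrow> 's set \<Rightarrow> ('s \<Rightarrow> real^2 \<Rightarrow> real^2) \<Rightarrow>
    ('s \<Rightarrow> real^2 \<Rightarrow> real^2) \<Rightarrow> ('s \<times> 's) set" where
  "edge_adjacency J G S f \<phi> =
    {(s, s'). s \<in> S \<and> s' \<in> S \<and> s \<noteq> s' \<and> meet_at_edge J G f \<phi> s s'}"

text \<open>
  \<open>r\<close> and, on \<open>S\<close>, \<open>\<phi>\<close> and \<open>c\<close> are determined by \<open>f\<close>, so it does not matter that the existential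
  quantifier ranges over all clauses.  The last clause is connectedness of an undirected graph on \<open>S\<close>.
\<close>

definition ss_system ::
  "nat \<Rightarrow> (real^2 \<Rightarrow> real^2) set \<Rightarrow> 's set \<Rightarrow> ('s \<Rightarrow> real^2 \<Rightarrow> real^2) \<Rightarrow> bool" where
  "ss_system J G S f \<longleftrightarrow>
    subgroup G (D_group J) \<and> finite S \<and>
    (\<forall>s\<in>S. \<exists>L<1. L-lipschitz_on UNIV (f s)) \<and>
    (\<exists>r \<phi> c.
      0 < r \<and> r < 1 \<and>
      (\<forall>s\<in>S. \<phi> s \<in> D_ext J \<and> (\<forall>x. f s x = r *\<^sub>R \<phi> s x + c s) \<and>
              f s ` polygon J \<subseteq> polygon J) \<and>
      (\<forall>i. \<exists>s\<in>S. \<exists>j. f s ` edge J j \<subseteq> edge J i) \<and>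
      (\<forall>g\<in>G. \<exists>h\<in>S \<rightarrow> S. \<forall>s\<in>S. Hilbert_Choice.inv (f (h s)) \<circ> g \<circ> f s \<in> G) \<and>
      (\<forall>s\<in>S. \<forall>s'\<in>S. s \<noteq> s' \<and> f s ` polygon J \<inter> f s' ` polygon J \<noteq> {} \<longrightarrow>
              meet_at_edge J G f \<phi> s s' \<or> meet_at_vertex J f s s') \<and>
      (\<forall>s\<in>S. \<forall>s'\<in>S. (s, s') \<in> (edge_adjacency J G S f \<phi> \<union> (edge_adjacency J G S f \<phi>)\<inverse>)\<^sup>*))"

text \<open>The set \<open>T\<close> of words is \<open>lists S\<close>, with the empty word \<open>[]\<close>.\<close>

fun word_map :: "('s \<Rightarrow> real^2 \<Rightarrow> real^2) \<Rightarrow> 's list \<Rightarrow> real^2 \<Rightarrow> real^2" where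
  "word_map f [] = id"
| "word_map f (s # w) = f s \<circ> word_map f w"

definition self_similar_set :: "'s set \<Rightarrow> ('s \<Rightarrow> real^2 \<Rightarrow> real^2) \<Rightarrow> (real^2) set" where
  "self_similar_set S f = (THE K. K \<noteq> {} \<and> compact K \<and> K = (\<Union>s\<in>S. f s ` K))"

definition G_star :: "nat \<Rightarrow> 's set \<Rightarrow> ('s \<Rightarrow> real^2 \<Rightarrow> real^2) \<Rightarrow> (real^2 \<Rightarrow> real^2) set" where
  "G_star J S f =
    {g \<in> D_set J. \<forall>w\<in>lists S. \<exists>v\<in>lists S. length v = length w \<and>
        g ` word_map f w ` polygon J = word_map f v ` polygon J}"

text \<open>The word $g_*(w)$; meaningful for \<open>g \<in> G_star J S f\<close> and \<open>w \<in> lists S\<close>.\<close>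

definition star_word ::
  "nat \<Rightarrow> 's set \<Rightarrow> ('s \<Rightarrow> real^2 \<Rightarrow> real^2) \<Rightarrow> (real^2 \<Rightarrow> real^2) \<Rightarrow> 's list \<Rightarrow> 's list" where
  "star_word J S f g w =
    (THE v. v \<in> lists S \<and> length v = length w \<and>
        g ` word_map f w ` polygon J = word_map f v ` polygon J)"

end

theory Submission
  imports Defs
begin

text \<open>
  The attractor \<open>K\<close> is the intersection of the levels \<open>\<Union>{Q\<^sub>w. |w| = n}\<close>, because every \<open>f\<^sub>s\<close> maps the polygon
  into itself. More generally, \<open>x \<in> K\<^sub>w\<close> if and only if for every \<open>n\<close> some word \<open>u\<close> of length \<open>n\<close>
  has \<open>x \<in> Q\<^bsub>wu\<^esub>\<close>. So statements about \<open>K\<close> become statements about polygons.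

  Points on the edges. Every level has a cell with an edge inside \<open>b\<^sub>i\<close>, so \<open>K\<close> meets \<open>b\<^sub>i\<close> by compactness.

  Symmetries. Cells of the same level with different words have disjoint interiors, since first-level
  cells share at most an edge (\<open>cores_disjoint\<close>). Hence a cell contained in \<open>Q\<^sub>w\<close>, of at least the same
  level, has a word that extends \<open>w\<close>. If \<open>g\<close> permutes cells, the words of the images of the cells
  inside \<open>Q\<^sub>w\<close> therefore extend \<open>g\<^sub>*(w)\<close>, and \<open>g(K\<^sub>w) \<subseteq> K\<^bsub>g\<^sub>*(w)\<^esub>\<close> follows; the inverse of \<open>g\<close> gives
  the other inclusion (\<open>G_star_attractor\<close>).

  Reflections. Two copies of the polygon of equal size that meet exactly in a common edge have
  their centres exchanged by the reflection \<open>R\<close> in that edge (\<open>mirrored_centre\<close>). For two letters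
  \<open>s\<close> and \<open>t\<close> this makes \<open>(f\<^sub>t)\<^sup>-\<^sup>1 \<circ> R \<circ> f\<^sub>s\<close> linear, and the system puts its linear part in \<open>G\<close>. For
  words \<open>w\<close> and \<open>v\<close>, freed of their common prefix, \<open>R\<close> is the reflection belonging to their first
  letters. Pushing the resulting element of \<open>G\<close> through the remaining letters gives
  \<open>R \<circ> f\<^sub>w = f\<^sub>z \<circ> g\<close> with \<open>g \<in> G\<close> and a word \<open>z\<close> of the same length. By \<open>mirrored_centre\<close> for words, \<open>Q\<^sub>z\<close>
  and \<open>Q\<^sub>v\<close> have the same centre, so \<open>z = v\<close> (\<open>word_reflection\<close>). Since \<open>R\<close> fixes the image of a point of
  \<open>K \<inter> b\<^sub>i\<close>, the pieces \<open>K\<^sub>w\<close> and \<open>K\<^sub>v\<close> meet.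

  Connectedness. By the previous paragraph, neighbours in the adjacency graph of the letters have pieces that meet.
  Suppose that \<open>K\<close> splits into two parts at distance at least \<open>r e\<close>. Either some first-level piece is cut,
  and then its blow-up is a splitting of \<open>K\<close> at distance at least \<open>e\<close>; or each piece lies in one part, and
  then all lie in the same one because the graph is connected. Induction excludes gaps of size
  \<open>r\<^sup>n d\<close> for all \<open>n\<close>, with \<open>d\<close> above the diameter (\<open>gap_free_shrink\<close>), so \<open>K\<close> is connected.
\<close>

section \<open>Similitudes and reflections\<close>

definition similitude :: "real \<Rightarrow> (real^2 \<Rightarrow> real^2) \<Rightarrow> bool" where
  "similitude k F \<longleftrightarrow> 0 < k \<and>
     (\<exists>A c. orthogonal_transformation A \<and> (\<forall>x. F x = k *\<^sub>R A x + c))"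

lemma similitudeE:
  assumes "similitude k F"
  obtains A c where "0 < k" "linear A" "orthogonal_transformation A"
    "\<And>x y. A x \<bullet> A y = x \<bullet> y" "\<And>x. norm (A x) = norm x" "\<And>x. F x = k *\<^sub>R A x + c"
proof -
  from assms obtain A c where "0 < k" and A: "orthogonal_transformation A" and "\<And>x. F x = k *\<^sub>R A x + c"
    unfolding similitude_def by blast
  then show thesis
    using that[of A c] A orthogonal_transformation_norm[OF A]
    unfolding orthogonal_transformation_def by blast
qed

lemma similitude_id: "similitude 1 id"
  unfolding similitude_def
  by (intro conjI exI[of _ "\<lambda>x. x"] exI[of _ 0]) simp_all

lemma similitude_comp:
  assumes "similitude k F" "similitude l F'"
  shows "similitude (k * l) (F \<circ> F')"
proof -
  obtain A c where A: "0 < k" "linear A" "orthogonal_transformation A" "\<And>x. F x = k *\<^sub>R A x + c"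
    using assms(1) by (rule similitudeE) blast
  obtain B d where B: "0 < l" "orthogonal_transformation B" "\<And>x. F' x = l *\<^sub>R B x + d"
    using assms(2) by (rule similitudeE) blast
  have "(F \<circ> F') x = (k * l) *\<^sub>R (A \<circ> B) x + (k *\<^sub>R A d + c)" for x
    using A(2) by (simp add: A(4) B(3) linear_add linear_scale scaleR_add_right)
  then show ?thesis
    unfolding similitude_def
    using A B orthogonal_transformation_compose by (metis mult_pos_pos)
qed

lemma similitude_inner_diff:
  assumes "similitude k F"
  shows "(F x - F y) \<bullet> (F u - F v) = k\<^sup>2 * ((x - y) \<bullet> (u - v))"
proof -
  obtain A c where A: "linear A" "\<And>x y. A x \<bullet> A y = x \<bullet> y" "\<And>x. F x = k *\<^sub>R A x + c"
    using assms by (rule similitudeE) blast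
  have d: "F x - F y = k *\<^sub>R A (x - y)" for x y
    by (simp add: A(3) linear_diff[OF A(1)] scaleR_diff_right)
  show ?thesis
    by (simp add: d A(2) power2_eq_square)
qed

lemma similitude_dist:
  assumes "similitude k F"
  shows "dist (F x) (F y) = k * dist x y"
proof -
  obtain A c where A: "0 < k" "linear A" "\<And>x. norm (A x) = norm x" "\<And>x. F x = k *\<^sub>R A x + c"
    using assms by (rule similitudeE) blast
  have "F x - F y = k *\<^sub>R A (x - y)"
    by (simp add: A(4) linear_diff[OF A(2)] scaleR_diff_right)
  then show ?thesis
    using A by (simp add: dist_norm)
qed

lemma similitude_bij:
  assumes "similitude k F"
  shows "bij F"
proof -
  obtain A c where A: "0 < k" "orthogonal_transformation A" "\<And>x. F x = k *\<^sub>R A x + c"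
    using assms by (rule similitudeE) blast
  have "inj F"
    using A(1) similitude_dist[OF assms] by (metis dist_eq_0_iff injI mult_eq_0_iff less_irrefl)
  moreover have "surj F"
  proof (rule surjI)
    fix y
    show "F (Hilbert_Choice.inv A ((1/k) *\<^sub>R (y - c))) = y"
      using A(1) orthogonal_transformation_surj[OF A(2)] by (simp add: A(3) surj_f_inv_f)
  qed
  ultimately show ?thesis by (simp add: bij_def)
qed

lemma similitude_inj: "similitude k F \<Longrightarrow> inj F"
  using similitude_bij bij_is_inj by blast

lemma similitude_continuous:
  assumes "similitude k F"
  shows "continuous_on X F"
proof -
  obtain A c where A: "linear A" "\<And>x. F x = k *\<^sub>R A x + c"
    using assms by (rule similitudeE) blast
  have "continuous_on X (\<lambda>x. k *\<^sub>R A x + c)"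
    using A(1) by (intro continuous_intros linear_continuous_on linear_conv_bounded_linear[THEN iffD1])
  then show ?thesis using A(2) by simp
qed

lemma similitude_image_affine_hull:
  assumes "similitude k F"
  shows "F ` (affine hull X) = affine hull (F ` X)"
proof -
  obtain A c where A: "linear A" "\<And>x. F x = k *\<^sub>R A x + c"
    using assms by (rule similitudeE) blast
  have bl: "bounded_linear (\<lambda>x. k *\<^sub>R A x)"
    using A(1) by (simp add: linear_compose_scale_right linear_conv_bounded_linear[THEN iffD1])
  have F: "F ` Y = (+) c ` (\<lambda>x. k *\<^sub>R A x) ` Y" for Y
    by (auto simp: A(2) image_iff add.commute)
  show ?thesis
    by (simp only: F affine_hull_linear_image[OF bl] affine_hull_translation)
qed

lemma similitude_image_segment:
  assumes "similitude k F"
  shows "F ` closed_segment a b = closed_segment (F a) (F b)"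
proof -
  obtain A c where A: "linear A" "\<And>x. F x = k *\<^sub>R A x + c"
    using assms by (rule similitudeE) blast
  have l: "linear (\<lambda>x. k *\<^sub>R A x)"
    using A(1) by (simp add: linear_compose_scale_right)
  have F: "F ` Y = (+) c ` (\<lambda>x. k *\<^sub>R A x) ` Y" for Y
    by (auto simp: A(2) image_iff add.commute)
  show ?thesis
    by (simp only: F closed_segment_linear_image[OF l, symmetric] closed_segment_translation[symmetric])
      (simp add: A(2) add.commute)
qed

lemma similitude_midpoint:
  assumes "similitude k F"
  shows "F (midpoint a b) = midpoint (F a) (F b)"
proof -
  obtain A c where A: "linear A" "\<And>x. F x = k *\<^sub>R A x + c"
    using assms by (rule similitudeE) blast
  show ?thesis
    by (simp add: A(2) midpoint_eq_iff linear_add[OF A(1), symmetric] scaleR_2[symmetric])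
      (simp add: midpoint_def linear_scale[OF A(1)] linear_add[OF A(1)] scaleR_right_distrib scaleR_2)
qed

lemma similitude_interior:
  assumes "similitude k F"
  shows "F ` interior X = interior (F ` X)"
proof -
  obtain A c where A: "0 < k" "orthogonal_transformation A" "linear A" "\<And>x. F x = k *\<^sub>R A x + c"
    using assms by (rule similitudeE) blast
  have l: "linear (\<lambda>x. k *\<^sub>R A x)" "inj (\<lambda>x. k *\<^sub>R A x)"
    using A orthogonal_transformation_inj[OF A(2)]
    by (auto simp: linear_compose_scale_right inj_def)
  have F: "F ` Y = (+) c ` (\<lambda>x. k *\<^sub>R A x) ` Y" for Y
    by (auto simp: A(4) image_iff add.commute)
  show ?thesis
    by (simp only: F interior_translation interior_injective_linear_image[OF l])
qed

text \<open>A similitude multiplies all distances by the same factor, so it carries closest points to closest points;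
  being affine, it then carries reflections to reflections.\<close>

lemma reflect_in_similitude:
  assumes "similitude k F" "affine L" "L \<noteq> {}"
  shows "reflect_in (F ` L) (F x) = F (reflect_in L x)"
proof -
  obtain A c where A: "0 < k" "linear A" "\<And>x. F x = k *\<^sub>R A x + c"
    using assms(1) by (rule similitudeE) blast
  have L: "closed L" using assms(2) by (rule affine_closed)
  have aff: "affine (F ` L)"
    using similitude_image_affine_hull[OF assms(1), of L] assms(2) affine_hull_eq affine_affine_hull
    by metis
  have "F (closest_point L x) = closest_point (F ` L) (F x)"
  proof (rule closest_point_unique)
    show "convex (F ` L)" "closed (F ` L)"
      using aff by (auto intro: affine_imp_convex affine_closed)
    show "F (closest_point L x) \<in> F ` L"
      using L assms(3) closest_point_in_set by blast
    show "\<forall>z\<in>F ` L. dist (F x) (F (closest_point L x)) \<le> dist (F x) z"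
      using closest_point_le[OF L] A(1) by (auto simp: similitude_dist[OF assms(1)])
  qed
  then have "reflect_in (F ` L) (F x) = 2 *\<^sub>R F (closest_point L x) - F x"
    by (simp add: reflect_in_def)
  also have "\<dots> = F (reflect_in L x)"
    by (simp add: reflect_in_def A(3) linear_diff[OF A(2)] linear_scale[OF A(2)]
        scaleR_2[of c] scaleR_diff_right scaleR_add_right mult.commute)
  finally show ?thesis .
qed

text \<open>The point of the line nearest to \<open>x\<close> is reached along the unit normal \<open>n\<close>, and
  Cauchy-Schwarz shows that nothing on the line is nearer.\<close>

lemma reflect_in_hyperplane:
  fixes n :: "real^2"
  assumes "norm n = 1"
  shows "reflect_in {x. n \<bullet> x = \<beta>} x = x - (2 * (n \<bullet> x - \<beta>)) *\<^sub>R n"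
proof -
  let ?y = "x - (n \<bullet> x - \<beta>) *\<^sub>R n"
  have nn: "n \<bullet> n = 1" using assms by (simp add: norm_eq_1)
  have "?y = closest_point {x. n \<bullet> x = \<beta>} x"
  proof (rule closest_point_unique)
    show "convex {x. n \<bullet> x = \<beta>}" by (rule convex_hyperplane)
    show "closed {x. n \<bullet> x = \<beta>}" by (rule closed_hyperplane)
    show "?y \<in> {x. n \<bullet> x = \<beta>}"
      by (simp add: inner_diff_right nn)
    show "\<forall>z\<in>{x. n \<bullet> x = \<beta>}. dist x ?y \<le> dist x z"
    proof safe
      fix z assume "\<beta> = n \<bullet> z"
      then have "\<bar>n \<bullet> x - n \<bullet> z\<bar> \<le> norm n * norm (x - z)"
        using Cauchy_Schwarz_ineq2[of n "x - z"] by (simp add: inner_diff_right)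
      then show "dist x (x - (n \<bullet> x - n \<bullet> z) *\<^sub>R n) \<le> dist x z"
        using assms by (simp add: dist_norm)
    qed
  qed
  then have "reflect_in {x. n \<bullet> x = \<beta>} x = 2 *\<^sub>R ?y - x"
    by (simp only: reflect_in_def)
  also have "\<dots> = x - (2 * (n \<bullet> x - \<beta>)) *\<^sub>R n"
    by (simp add: algebra_simps scaleR_2)
  finally show ?thesis .
qed

section \<open>Geometry of the regular polygon\<close>

lemma inner_dir: "dir s \<bullet> dir t = cos (s - t)"
  by (simp add: dir_def inner_vec_def sum_2 cos_diff)

lemma norm_dir [simp]: "norm (dir t) = 1"
  by (simp add: norm_eq_1 inner_dir)

lemma dir_add: "dir (s + t) = cos t *\<^sub>R dir s + sin t *\<^sub>R dir (s + pi/2)"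
  by (simp add: dir_def vec_eq_iff forall_2 cos_add sin_add)

lemma dir_frame: "x = (dir (t - pi/2) \<bullet> x) *\<^sub>R dir (t - pi/2) + (dir t \<bullet> x) *\<^sub>R dir t"
proof -
  have c: "cos (t - pi/2) = sin t" "sin (t - pi/2) = - cos t"
    by (simp_all add: cos_diff sin_diff)
  have "a = cos t * (cos t * a) + sin t * (sin t * a)" for a
    using sin_cos_squared_add3[of t] by (simp flip: mult.assoc distrib_right)
  from this[of "x $ 1"] this[of "x $ 2"] show ?thesis
    by (simp add: dir_def inner_vec_def sum_2 vec_eq_iff forall_2 c algebra_simps)
qed

lemma unit_vector_dir:
  fixes u :: "real^2"
  assumes "norm u = 1"
  obtains t where "u = dir t"
proof -
  have "(u $ 1)\<^sup>2 + (u $ 2)\<^sup>2 = 1"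
    using assms by (simp add: norm_eq_1 inner_vec_def sum_2 power2_eq_square)
  then obtain t where "u $ 1 = cos t" "u $ 2 = sin t"
    using sincos_total_2pi_le by metis
  then have "u = dir t"
    by (simp add: dir_def vec_eq_iff forall_2)
  then show thesis by (rule that)
qed

lemma dir_periodic_int: "dir (t + 2 * pi * of_int q) = dir t"
  by (simp add: dir_def cos_add sin_add cos_int_2pin sin_int_2pin)

text \<open>The same vector is the outward unit normal of the edge \<open>b\<^sub>i\<close> and, because the polygon
  is scaled to have inradius \<open>1\<close>, the midpoint of \<open>b\<^sub>i\<close>
  (\<open>apothem_midpoint\<close>). All metric facts about the edge are expressed through it.\<close>

definition apothem :: "nat \<Rightarrow> int \<Rightarrow> real^2" where
  "apothem J i = dir (rho J i - pi / 2)"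

lemma norm_apothem [simp]: "norm (apothem J i) = 1"
  by (simp add: apothem_def)

lemma apothem_inner_self [simp]: "apothem J i \<bullet> apothem J i = 1"
  by (simp add: apothem_def inner_dir)

lemma apothem_orthogonal_dir [simp]: "apothem J i \<bullet> dir (rho J i) = 0"
  by (simp add: apothem_def inner_dir)

text \<open>The direction \<open>\<rho>(i)\<close> is that of the edge \<open>b\<^sub>i\<close>: the line through
  \<open>0\<close> parallel to \<open>b\<^sub>i\<close> is orthogonal to the apothem, which makes
  \<open>R\<^bsub>\<rho>(i)\<^esub>\<close> the linear part of the reflection in the line containing
  \<open>b\<^sub>i\<close>.\<close>

lemma span_dir_rho: "span {dir (rho J i)} = {x. apothem J i \<bullet> x = 0}"
proof (intro equalityI subsetI)
  fix x assume "x \<in> span {dir (rho J i)}"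
  then show "x \<in> {x. apothem J i \<bullet> x = 0}"
    by (auto simp: span_singleton)
next
  fix x assume "x \<in> {x. apothem J i \<bullet> x = 0}"
  then have "x = (dir (rho J i) \<bullet> x) *\<^sub>R dir (rho J i)"
    using dir_frame[of x "rho J i"] by (simp add: apothem_def)
  then show "x \<in> span {dir (rho J i)}"
    by (metis span_base span_mul singletonI)
qed

lemma reflect_dir_rho: "reflect_dir (rho J i) x = x - (2 * (apothem J i \<bullet> x)) *\<^sub>R apothem J i"
  unfolding reflect_dir_def span_dir_rho by (simp add: reflect_in_hyperplane)

lemma orthogonal_reflect_dir: "orthogonal_transformation (reflect_dir (rho J i))"
proof -
  have "linear (reflect_dir (rho J i))"
    by (rule linearI) (simp_all add: reflect_dir_rho inner_add_right algebra_simps)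
  then show ?thesis
    unfolding orthogonal_transformation_def
    by (simp add: reflect_dir_rho inner_diff_left inner_diff_right inner_commute)
qed

text \<open>Seen from the centre, a vertex makes an odd multiple of \<open>\<pi>/J\<close> with an apothem. Up to sign
  and full turns such a multiple lies between \<open>\<pi>/J\<close> and \<open>\<pi>\<close>, where the cosine
  decreases.\<close>

lemma cos_odd_multiple_le:
  fixes m :: int
  assumes "odd m" "J \<noteq> 0"
  shows "cos (of_int m * pi / real J) \<le> cos (pi / real J)"
proof -
  define k where "k = m mod (2 * int J)"
  define q where "q = m div (2 * int J)"
  have m: "m = 2 * int J * q + k"
    by (simp add: k_def q_def)
  have "odd k"
    using assms(1) unfolding m by simp
  moreover have "0 \<le> k" "k < 2 * int J"
    using assms(2) by (simp_all add: k_def)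
  ultimately have k: "0 \<le> k" "k < 2 * int J" "odd k"
    by blast+
  then have "1 \<le> k" by (cases "k = 0") auto
  have "of_int m * pi / real J = of_int k * pi / real J + 2 * pi * of_int q"
    using assms by (simp add: m field_simps)
  then have eq: "cos (of_int m * pi / real J) = cos (of_int k * pi / real J)"
    by (simp add: cos_add cos_int_2pin sin_int_2pin)
  show ?thesis
  proof (cases "k \<le> int J")
    case True
    then have "cos (of_int k * pi / real J) \<le> cos (pi / real J)"
      using \<open>1 \<le> k\<close> assms by (intro cos_monotone_0_pi_le) (simp_all add: field_simps)
    then show ?thesis by (simp add: eq)
  next
    case False
    define l where "l = 2 * int J - k"
    have l: "1 \<le> l" "l \<le> int J" using False k by (auto simp: l_def)
    have "of_int k * pi / real J = 2 * pi - of_int l * pi / real J"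
      using assms by (simp add: l_def field_simps)
    then have "cos (of_int k * pi / real J) = cos (of_int l * pi / real J)"
      by (simp add: cos_diff)
    moreover have "cos (of_int l * pi / real J) \<le> cos (pi / real J)"
      using l assms by (intro cos_monotone_0_pi_le) (simp_all add: field_simps)
    ultimately show ?thesis by (simp add: eq)
  qed
qed

context
  fixes J :: nat
  assumes J: "3 \<le> J"
begin

lemma cos_pi_J_pos: "0 < cos (pi / real J)"
proof -
  have "pi / real J < pi / 2" using J by (intro divide_strict_left_mono) auto
  then show ?thesis using J by (intro cos_gt_zero) auto
qed

lemma tan_pi_J_pos: "0 < tan (pi / real J)"
proof -
  have "pi / real J < pi / 2" using J by (intro divide_strict_left_mono) auto
  then show ?thesis using J by (intro tan_gt_zero) auto
qed

lemma vertex_apothem: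
  "vertex J i = apothem J i + tan (pi / real J) *\<^sub>R dir (rho J i)"
  "vertex J (i - 1) = apothem J i - tan (pi / real J) *\<^sub>R dir (rho J i)"
proof -
  have "theta J i = (rho J i - pi/2) + pi / real J"
    by (simp add: theta_def rho_def)
  then have "dir (theta J i) = cos (pi / real J) *\<^sub>R apothem J i + sin (pi / real J) *\<^sub>R dir (rho J i)"
    using dir_add[of "rho J i - pi/2" "pi / real J"] by (simp add: apothem_def)
  then show "vertex J i = apothem J i + tan (pi / real J) *\<^sub>R dir (rho J i)"
    using cos_pi_J_pos by (simp add: vertex_def scaleR_add_right tan_def)
  have "theta J (i - 1) = (rho J i - pi/2) + - (pi / real J)"
    using J by (simp add: theta_def rho_def field_simps)
  then have "dir (theta J (i - 1)) = cos (pi / real J) *\<^sub>R apothem J i - sin (pi / real J) *\<^sub>R dir (rho J i)"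
    using dir_add[of "rho J i - pi/2" "- (pi / real J)"] by (simp add: apothem_def)
  then show "vertex J (i - 1) = apothem J i - tan (pi / real J) *\<^sub>R dir (rho J i)"
    using cos_pi_J_pos by (simp add: vertex_def scaleR_diff_right tan_def)
qed

lemma apothem_midpoint: "apothem J i = midpoint (vertex J (i - 1)) (vertex J i)"
  by (simp add: midpoint_def vertex_apothem(2)[of i] vertex_apothem(1)[of i])

lemma apothem_inner_ends: "apothem J i \<bullet> vertex J i = 1" "apothem J i \<bullet> vertex J (i - 1) = 1"
  by (simp_all add: vertex_apothem(1)[of i] vertex_apothem(2)[of i] inner_add_right inner_diff_right)

lemma apothem_orthogonal_edge: "apothem J i \<bullet> (vertex J i - vertex J (i - 1)) = 0"
  by (simp add: apothem_inner_ends inner_diff_right)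

lemma edge_ends_distinct: "vertex J (i - 1) \<noteq> vertex J i"
proof
  have "dir (rho J i) \<bullet> vertex J i = tan (pi / real J)"
    "dir (rho J i) \<bullet> vertex J (i - 1) = - tan (pi / real J)"
    by (simp_all add: vertex_apothem(1)[of i] vertex_apothem(2)[of i] inner_add_right inner_diff_right
        inner_commute[of "dir (rho J i)" "apothem J i"] inner_dir)
  moreover assume "vertex J (i - 1) = vertex J i"
  ultimately show False
    using tan_pi_J_pos by simp
qed

lemma edge_line: "affine hull (edge J i) = {x. apothem J i \<bullet> x = 1}"
proof (intro equalityI)
  let ?n = "apothem J i" and ?d = "dir (rho J i)" and ?t = "tan (pi / real J)"
  have e: "affine hull (edge J i) = affine hull {?n - ?t *\<^sub>R ?d, ?n + ?t *\<^sub>R ?d}"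
    by (simp add: edge_def vertex_apothem(1)[of i] vertex_apothem(2)[of i])
  show "affine hull (edge J i) \<subseteq> {x. ?n \<bullet> x = 1}"
    unfolding e by (rule hull_minimal) (auto simp: affine_hyperplane inner_add_right inner_diff_right)
  show "{x. ?n \<bullet> x = 1} \<subseteq> affine hull (edge J i)"
  proof
    fix x assume "x \<in> {x. ?n \<bullet> x = 1}"
    then have x: "x = ?n + (?d \<bullet> x) *\<^sub>R ?d"
      using dir_frame[of x "rho J i"] by (simp add: apothem_def)
    define s where "s = (?d \<bullet> x) / ?t"
    have s: "?d \<bullet> x = s * ?t" using tan_pi_J_pos by (simp add: s_def)
    have "x = ((1 - s) / 2) *\<^sub>R (?n - ?t *\<^sub>R ?d) + ((1 + s) / 2) *\<^sub>R (?n + ?t *\<^sub>R ?d)"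
    proof -
      have "((1 - s) / 2) *\<^sub>R (?n - ?t *\<^sub>R ?d) + ((1 + s) / 2) *\<^sub>R (?n + ?t *\<^sub>R ?d)
          = ((1 - s) / 2 + (1 + s) / 2) *\<^sub>R ?n + ((1 + s) / 2 * ?t - (1 - s) / 2 * ?t) *\<^sub>R ?d"
        by (simp only: scaleR_add_left scaleR_add_right scaleR_diff_left scaleR_diff_right scaleR_scaleR)
          (simp only: diff_conv_add_uminus add_ac)
      also have "(1 - s) / 2 + (1 + s) / 2 = 1" by (simp add: field_simps)
      also have "(1 + s) / 2 * ?t - (1 - s) / 2 * ?t = s * ?t" by (simp add: field_simps)
      finally show ?thesis using x s by simp
    qed
    moreover have "(1 - s) / 2 + (1 + s) / 2 = 1" by (simp add: field_simps)
    ultimately show "x \<in> affine hull (edge J i)"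
      unfolding e affine_hull_2 by blast
  qed
qed

lemma edge_subset_line: "edge J i \<subseteq> {x. apothem J i \<bullet> x = 1}"
  using edge_line hull_subset by metis

text \<open>The affine reflection differs from the linear one, \<open>reflect_dir_rho\<close>, by the translation by
  twice the apothem; so it sends the centre \<open>0\<close> of the polygon to twice the apothem.\<close>

lemma reflect_in_edge:
  "reflect_in (affine hull (edge J i)) x = x - (2 * (apothem J i \<bullet> x - 1)) *\<^sub>R apothem J i"
  unfolding edge_line by (simp add: reflect_in_hyperplane)

lemma zero_not_in_edge: "0 \<notin> edge J i"
  using edge_subset_line[of i] by auto

lemma vertex_in_polygon: "vertex J i \<in> polygon J"
proof -
  have "theta J i = theta J (i mod int J) + 2 * pi * of_int (i div int J)"
  proof -
    have "real_of_int i = real_of_int (i mod int J) + real J * of_int (i div int J)"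
      by (metis add.commute mult_div_mod_eq of_int_add of_int_mult of_int_of_nat_eq)
    then have "2 * pi / real J * real_of_int i
       = 2 * pi / real J * real_of_int (i mod int J) + 2 * pi * of_int (i div int J)"
      using J by (simp add: field_simps)
    then show ?thesis by (simp add: theta_def)
  qed
  then have "vertex J i = vertex J (i mod int J)"
    by (simp add: vertex_def dir_periodic_int)
  moreover have "i mod int J \<in> {0..int J - 1}"
    using J by (simp add: pos_mod_bound)
  ultimately show ?thesis
    unfolding polygon_def by (metis hull_inc imageI)
qed

lemma polygon_in_halfplane: "polygon J \<subseteq> {x. apothem J i \<bullet> x \<le> 1}"
  unfolding polygon_def
proof (rule hull_minimal)
  show "convex {x. apothem J i \<bullet> x \<le> 1}" by (rule convex_halfspace_le)
  show "vertex J ` {0..int J - 1} \<subseteq> {x. apothem J i \<bullet> x \<le> 1}"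
  proof safe
    fix k :: int
    have "(rho J i - pi / 2) - theta J k = of_int (2 * (i - k) - 1) * pi / real J"
      using J by (simp add: rho_def theta_def field_simps)
    then have "apothem J i \<bullet> dir (theta J k) \<le> cos (pi / real J)"
      using cos_odd_multiple_le[of "2 * (i - k) - 1" J] J by (simp add: apothem_def inner_dir)
    then show "apothem J i \<bullet> vertex J k \<le> 1"
      using cos_pi_J_pos by (simp add: vertex_def field_simps)
  qed
qed

lemma compact_polygon: "compact (polygon J)"
  unfolding polygon_def by (intro finite_imp_compact_convex_hull) simp

text \<open>Consecutive vertices are \<open>2\<pi>/J\<close> apart, so every direction is within angle
  \<open>\<pi>/J\<close> of a vertex; the circumradius \<open>1 / cos (\<pi>/J)\<close> exactly compensates the cosine
  of that angle.\<close>

lemma vertex_in_direction: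
  fixes u :: "real^2"
  assumes "norm u = 1"
  shows "\<exists>i. 1 \<le> u \<bullet> vertex J i"
proof -
  obtain t where t: "u = dir t" using unit_vector_dir[OF assms] .
  define y where "y = (t + pi / 2) * real J / (2 * pi)"
  define i where "i = \<lfloor>y\<rfloor>"
  have "theta J i - t = (2 * pi / real J) * (1/2 + of_int i - y)"
    using J by (simp add: theta_def y_def field_simps)
  then have "\<bar>theta J i - t\<bar> = (2 * pi / real J) * \<bar>1/2 + of_int i - y\<bar>"
    using J by (simp only: abs_mult) simp
  also have "\<dots> \<le> (2 * pi / real J) * (1/2)"
    unfolding i_def by (intro mult_left_mono; linarith?) simp
  finally have a: "\<bar>theta J i - t\<bar> \<le> pi / real J"
    by simp
  have "cos (pi / real J) \<le> cos \<bar>theta J i - t\<bar>"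
    using a J by (intro cos_monotone_0_pi_le) (auto simp: field_simps)
  then have "cos (pi / real J) \<le> u \<bullet> dir (theta J i)"
    by (simp add: t inner_dir) (metis cos_minus minus_diff_eq)
  then show ?thesis
    using cos_pi_J_pos by (intro exI[of _ i]) (simp add: vertex_def field_simps)
qed

text \<open>On the normal from the polygon towards a point of the disc, that point reaches at most \<open>1\<close>, while some
  vertex reaches at least \<open>1\<close> (\<open>vertex_in_direction\<close>). So no line separates the point strictly from
  the polygon.\<close>

lemma unit_disc_subset_polygon: "cball 0 1 \<subseteq> polygon J"
proof
  fix z :: "real^2" assume z: "z \<in> cball 0 1"
  show "z \<in> polygon J"
  proof (rule ccontr)
    assume "z \<notin> polygon J"
    then obtain a b where ab: "a \<bullet> z < b" "\<And>x. x \<in> polygon J \<Longrightarrow> b < a \<bullet> x"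
      using separating_hyperplane_closed_point[of "polygon J" z] compact_polygon
      by (auto simp: polygon_def compact_imp_closed)
    have "a \<noteq> 0" using ab vertex_in_polygon[of 0] by fastforce
    then obtain i where "1 \<le> ((- 1 / norm a) *\<^sub>R a) \<bullet> vertex J i"
      using vertex_in_direction[of "(- 1 / norm a) *\<^sub>R a"] by auto
    then have "a \<bullet> vertex J i \<le> - norm a"
      using \<open>a \<noteq> 0\<close> by (simp add: field_simps)
    then have "a \<bullet> z < - norm a"
      using ab vertex_in_polygon[of i] by fastforce
    moreover have "\<bar>a \<bullet> z\<bar> \<le> norm a * norm z" by (rule Cauchy_Schwarz_ineq2)
    moreover have "norm a * norm z \<le> norm a * 1"
      using z by (intro mult_left_mono) auto
    ultimately show False by linarith
  qed
qed

lemma zero_in_interior_polygon: "0 \<in> interior (polygon J)"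
proof -
  have "ball (0::real^2) 1 \<subseteq> interior (polygon J)"
    using unit_disc_subset_polygon ball_subset_cball by (intro interior_maximal) auto
  then show ?thesis by (auto dest: subsetD[of _ _ 0])
qed

lemma edge_interior_disjoint: "edge J i \<inter> interior (polygon J) = {}"
proof -
  have "apothem J i \<noteq> 0" using norm_apothem[of J i] by force
  then have "interior (polygon J) \<subseteq> {x. apothem J i \<bullet> x < 1}"
    using interior_mono[OF polygon_in_halfplane[of i]] by simp
  then show ?thesis using edge_subset_line[of i] by fastforce
qed

lemma vertex_in_edge: "vertex J i \<in> edge J i"
  by (simp add: edge_def)

end

section \<open>Gaps in compact sets\<close>

text \<open>Connectedness of a compact set is tested one scale \<open>e\<close> at a time: at scale \<open>e\<close>
  the set must not split into two nonempty parts at distance at least \<open>e\<close>. In this form the property passes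
  between a set and its scaled copies, the scale \<open>e\<close> changing by the same factor.\<close>

definition gap_free :: "'a::metric_space set \<Rightarrow> real \<Rightarrow> bool" where
  "gap_free X e \<longleftrightarrow> (\<forall>A\<subseteq>X. (\<forall>a\<in>A. \<forall>b\<in>X - A. e \<le> dist a b) \<longrightarrow> A = {} \<or> A = X)"

text \<open>Two points are never further apart than the diameter; \<open>connected_attractor\<close> starts its
  induction from this scale.\<close>

lemma gap_free_diameter:
  assumes "bounded X"
  shows "gap_free X (diameter X + 1)"
  unfolding gap_free_def
proof (intro allI impI)
  fix A assume A: "A \<subseteq> X" "\<forall>a\<in>A. \<forall>b\<in>X - A. diameter X + 1 \<le> dist a b"
  have False if "a \<in> A" "b \<in> X - A" for a b
  proof -
    have "diameter X + 1 \<le> dist a b" "dist a b \<le> diameter X"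
      using that A diameter_bounded_bound[OF assms, of a b] by blast+
    then show False by linarith
  qed
  then show "A = {} \<or> A = X" using A(1) by blast
qed

text \<open>The parts of a separation of a compact set are compact, hence a positive distance apart.\<close>

lemma connected_gap_free:
  fixes X :: "'a::heine_borel set"
  assumes "compact X" "\<And>e. 0 < e \<Longrightarrow> \<exists>e'\<le>e. gap_free X e'"
  shows "connected X"
proof (rule ccontr)
  assume "\<not> connected X"
  then obtain A B where AB: "closed A" "closed B" "A \<noteq> {}" "B \<noteq> {}" "A \<union> B = X" "A \<inter> B = {}"
    using connected_closed_set[OF compact_imp_closed[OF assms(1)]] by blast
  have "A = X \<inter> A" using AB(5) by blast
  then have "compact A" using compact_Int_closed[OF assms(1) AB(1)] by simp
  then obtain d where d: "0 < d" "\<forall>a\<in>A. \<forall>b\<in>B. d \<le> dist a b"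
    using separate_compact_closed[of A B] AB by blast
  then obtain e where "e \<le> d" "gap_free X e" using assms(2) by blast
  show False
  proof -
    have "\<forall>a\<in>A. \<forall>b\<in>X - A. e \<le> dist a b"
      using AB(5) d(2) \<open>e \<le> d\<close> by fastforce
    then have "A = {} \<or> A = X"
      using \<open>gap_free X e\<close> AB(5) unfolding gap_free_def by blast
    then show False using AB by blast
  qed
qed

section \<open>Attractors as nested intersections of cells\<close>

lemma word_map_append: "word_map f (u @ v) = word_map f u \<circ> word_map f v"
  by (induction u) (simp_all add: comp_assoc)

locale nested_similitudes =
  fixes S :: "'s set" and f :: "'s \<Rightarrow> real^2 \<Rightarrow> real^2" and r :: real and Q :: "(real^2) set"
  assumes finite_S: "finite S" and S_nonempty: "S \<noteq> {}" and ratio: "0 < r" "r < 1"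
    and simil: "s \<in> S \<Longrightarrow> similitude r (f s)"
    and compact_Q: "compact Q" and Q_nonempty: "Q \<noteq> {}"
    and nested: "s \<in> S \<Longrightarrow> f s ` Q \<subseteq> Q"
begin

definition words :: "nat \<Rightarrow> 's list set" where
  "words n = {w \<in> lists S. length w = n}"

definition level :: "nat \<Rightarrow> (real^2) set" where
  "level n = (\<Union>w\<in>words n. word_map f w ` Q)"

definition attractor :: "(real^2) set" where
  "attractor = (\<Inter>n. level n)"

lemma finite_words: "finite (words n)"
proof -
  have "words n = {xs. set xs \<subseteq> S \<and> length xs = n}" by (auto simp: words_def)
  then show ?thesis using finite_lists_length_eq[OF finite_S] by simp
qed

lemma words_0 [simp]: "words 0 = {[]}"
  by (auto simp: words_def)

lemma words_Suc: "words (Suc n) = (\<lambda>(s, w). s # w) ` (S \<times> words n)"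
  by (auto simp: words_def length_Suc_conv image_iff)

lemma UN_words_Suc: "(\<Union>w\<in>words (Suc n). X w) = (\<Union>s\<in>S. \<Union>w\<in>words n. X (s # w))"
  by (auto simp: words_Suc)

lemma words_nonempty: "words n \<noteq> {}"
  using S_nonempty by (induction n) (auto simp: words_Suc)

lemma similitude_word: "w \<in> lists S \<Longrightarrow> similitude (r ^ length w) (word_map f w)"
proof (induction w)
  case Nil
  then show ?case using similitude_id by (simp add: id_def)
next
  case (Cons s w)
  then show ?case using similitude_comp[OF simil[of s], of "r ^ length w" "word_map f w"]
    by (simp add: comp_def)
qed

lemma cell_subset: "w \<in> lists S \<Longrightarrow> word_map f w ` Q \<subseteq> Q"
proof (induction w)
  case (Cons s w)
  then have "word_map f (s # w) ` Q \<subseteq> f s ` Q" by auto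
  then show ?case using Cons nested[of s] by auto
qed simp

lemma cell_append: "v \<in> lists S \<Longrightarrow> word_map f (u @ v) ` Q \<subseteq> word_map f u ` Q"
  using cell_subset[of v] by (auto simp: word_map_append)

lemma level_Suc: "level (Suc n) = (\<Union>s\<in>S. f s ` level n)"
proof -
  have "level (Suc n) = (\<Union>s\<in>S. \<Union>w\<in>words n. word_map f (s # w) ` Q)"
    unfolding level_def by (rule UN_words_Suc)
  then show ?thesis by (simp add: level_def image_UN image_comp)
qed

lemma level_Suc_subset: "level (Suc n) \<subseteq> level n"
proof (induction n)
  case 0
  then show ?case using nested by (auto simp: level_Suc) (auto simp: level_def)
next
  case (Suc n)
  then show ?case unfolding level_Suc[of "Suc n"] level_Suc[of n] by (intro UN_mono image_mono) auto
qed

lemma level_antimono: "m \<le> n \<Longrightarrow> level n \<subseteq> level m"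
  using level_Suc_subset by (rule lift_Suc_antimono_le)

lemma compact_level: "compact (level n)"
  unfolding level_def
proof (intro compact_UN finite_words)
  fix w assume "w \<in> words n"
  then have "similitude (r ^ length w) (word_map f w)" using similitude_word[of w] by (simp add: words_def)
  then show "compact (word_map f w ` Q)"
    using compact_Q by (intro compact_continuous_image similitude_continuous)
qed

lemma attractor_iff: "x \<in> attractor \<longleftrightarrow> (\<forall>n. \<exists>w\<in>words n. x \<in> word_map f w ` Q)"
  by (simp add: attractor_def level_def)

lemma compact_attractor: "compact attractor"
  unfolding attractor_def using compact_level by (intro compact_Inter) auto

text \<open>Closed sets that meet some cell of each level meet the attractor, by compactness. This is how points of
  the attractor on the edges are found.\<close>

lemma attractor_meets:
  assumes "closed X" "\<And>n. \<exists>w\<in>words n. word_map f w ` Q \<inter> X \<noteq> {}"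
  shows "attractor \<inter> X \<noteq> {}"
proof -
  have "(\<Inter>n. level n \<inter> X) \<noteq> {}"
  proof (rule compact_nest)
    show "compact (level n \<inter> X)" for n using compact_level assms(1) by blast
    show "level n \<inter> X \<noteq> {}" for n using assms(2)[of n] unfolding level_def by blast
    show "level n \<inter> X \<subseteq> level m \<inter> X" if "m \<le> n" for m n using level_antimono[OF that] by blast
  qed
  then show ?thesis by (auto simp: attractor_def)
qed

lemma attractor_nonempty: "attractor \<noteq> {}"
proof -
  have "\<exists>w\<in>words n. word_map f w ` Q \<inter> UNIV \<noteq> {}" for n
    using words_nonempty[of n] Q_nonempty by auto
  then show ?thesis using attractor_meets[of UNIV] by simp
qed

lemma attractor_fixed: "attractor = (\<Union>s\<in>S. f s ` attractor)"
proof (intro equalityI subsetI)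
  fix x assume x: "x \<in> attractor"
  then have "x \<in> level (Suc n)" for n unfolding attractor_def by blast
  then have "\<exists>s\<in>S. x \<in> f s ` level n" for n
    using level_Suc[of n] by blast
  then have "\<forall>n. \<exists>s. s \<in> S \<and> x \<in> f s ` level n" by blast
  from choice[OF this] obtain s where s: "\<And>n. s n \<in> S" "\<And>n. x \<in> f (s n) ` level n" by blast
  \<comment> \<open>Finitely many letters: one of them occurs for infinitely many \<open>n\<close>, and levels decrease.\<close>
  have "finite (range s)" using s(1) finite_S by (meson finite_subset image_subsetI)
  then obtain t where t: "infinite {n. s n = t}"
    using pigeonhole_infinite[of UNIV s] by auto
  then have "{n. s n = t} \<noteq> {}" by (metis finite.emptyI)
  then have "t \<in> S" using s(1) by blast
  have "x \<in> f t ` level n" for n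
  proof -
    obtain m where "m \<ge> n" "s m = t"
      using t unfolding infinite_nat_iff_unbounded_le by blast
    then show ?thesis using s(2)[of m] level_antimono[of n m] by blast
  qed
  then have "\<forall>n. \<exists>y. y \<in> level n \<and> x = f t y" by blast
  from choice[OF this] obtain y where y: "\<And>n. y n \<in> level n" "\<And>n. x = f t (y n)" by blast
  then have "y 0 = y n" for n
    using similitude_inj[OF simil[OF \<open>t \<in> S\<close>]] by (metis injD)
  then have "y 0 \<in> level n" for n using y(1)[of n] by metis
  then have "y 0 \<in> attractor" by (simp add: attractor_def)
  then show "x \<in> (\<Union>s\<in>S. f s ` attractor)" using y(2) \<open>t \<in> S\<close> by blast
next
  fix x assume "x \<in> (\<Union>s\<in>S. f s ` attractor)"
  then obtain s y where s: "s \<in> S" "x = f s y" "y \<in> attractor" by blast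
  then have "y \<in> level n" for n by (simp add: attractor_def)
  then have "x \<in> level (Suc n)" for n using s(1,2) unfolding level_Suc by blast
  then have "x \<in> level n" for n using level_Suc_subset by blast
  then show "x \<in> attractor" by (simp add: attractor_def)
qed

lemma power_times_small:
  assumes "0 < e"
  shows "\<exists>n. r ^ n * d < e"
proof -
  have "(\<lambda>n. r ^ n * d) \<longlonglongrightarrow> 0 * d"
    using ratio by (intro tendsto_intros LIMSEQ_realpow_zero) auto
  then have "\<forall>\<^sub>F n in sequentially. r ^ n * d < e"
    using assms by (intro order_tendstoD(2)) auto
  then show ?thesis
    by (meson eventually_sequentially order_refl)
qed

text \<open>A point of \<open>X\<close> lies, for every \<open>n\<close>, in the image of \<open>X\<close> under some
  word of length \<open>n\<close>; the image of \<open>Y\<close> under the same word is within \<open>r\<^sup>n\<close>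
  times the diameter of \<open>X \<union> Y\<close>.\<close>

lemma fixed_sets_subset:
  assumes X: "compact X" "X = (\<Union>s\<in>S. f s ` X)"
    and Y: "compact Y" "Y \<noteq> {}" "Y = (\<Union>s\<in>S. f s ` Y)"
  shows "X \<subseteq> Y"
proof
  fix x assume x: "x \<in> X"
  have bdd: "bounded (X \<union> Y)" using X(1) Y(1) by (simp add: compact_imp_bounded)
  define d where "d = diameter (X \<union> Y)"
  have near: "\<exists>y\<in>Y. dist x y \<le> r ^ n * d" if "x \<in> X" for n x
    using that
  proof (induction n arbitrary: x)
    case 0
    obtain y where "y \<in> Y" using Y(2) by blast
    then show ?case
      using 0 diameter_bounded_bound[OF bdd, of x y] by (auto simp: d_def)
  next
    case (Suc n)
    then obtain s x' where s: "s \<in> S" "x' \<in> X" "x = f s x'" using X(2) by blast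
    then obtain y where y: "y \<in> Y" "dist x' y \<le> r ^ n * d" using Suc.IH by blast
    have "f s y \<in> Y" using Y(3) s(1) y(1) by blast
    moreover have "dist x (f s y) \<le> r ^ Suc n * d"
      using y(2) ratio by (simp add: s(3) similitude_dist[OF simil[OF s(1)]])
    ultimately show ?case by blast
  qed
  have "x \<in> closure Y"
    unfolding closure_approachable
  proof (intro allI impI)
    fix e :: real assume "0 < e"
    then obtain n where "r ^ n * d < e"
      using power_times_small by blast
    then show "\<exists>y\<in>Y. dist y x < e"
      using near[OF x, of n] by (metis dist_commute le_less_trans)
  qed
  then show "x \<in> Y" using Y(1) compact_imp_closed closure_closed by metis
qed

lemma self_similar_set_attractor: "self_similar_set S f = attractor"
  unfolding self_similar_set_def
proof (rule the_equality)
  show "attractor \<noteq> {} \<and> compact attractor \<and> attractor = (\<Union>s\<in>S. f s ` attractor)"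
    using attractor_nonempty compact_attractor attractor_fixed by blast
  fix X assume "X \<noteq> {} \<and> compact X \<and> X = (\<Union>s\<in>S. f s ` X)"
  then show "X = attractor"
    using fixed_sets_subset[of X attractor] fixed_sets_subset[of attractor X]
      attractor_nonempty compact_attractor attractor_fixed by blast
qed

text \<open>Points of \<open>K\<^sub>w\<close> are recognised by the cells \<open>Q\<^bsub>wu\<^esub>\<close> alone. A
  map that permutes cells therefore permutes the pieces of the attractor.\<close>

lemma attractor_cell_iff:
  assumes "w \<in> lists S"
  shows "x \<in> word_map f w ` attractor \<longleftrightarrow> (\<forall>n. \<exists>u\<in>words n. x \<in> word_map f (w @ u) ` Q)"
proof -
  have bij: "bij (word_map f w)"
    using similitude_bij similitude_word[OF assms] by blast
  then obtain y where y: "x = word_map f w y" by (metis bij_pointE)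
  have inj: "word_map f w a = word_map f w b \<longleftrightarrow> a = b" for a b
    using bij by (meson bij_is_inj injD)
  show ?thesis
    by (auto simp: y word_map_append image_iff inj attractor_iff)
qed

section \<open>Connectedness of linked attractors\<close>

text \<open>A splitting of the attractor at distance \<open>r e\<close> cannot cut a first-level piece
  \<open>f\<^sub>s(K)\<close>, since pulling the cut back by \<open>f\<^sub>s\<close> would split the attractor at
  distance \<open>e\<close>. So each piece lies wholly on one side, and the links between pieces put all of them on the
  same side.\<close>

lemma gap_free_shrink:
  assumes chain: "\<And>s t. s \<in> S \<Longrightarrow> t \<in> S \<Longrightarrow> (s, t) \<in> E\<^sup>*"
    and meet: "\<And>s t. (s, t) \<in> E \<Longrightarrow> s \<in> S \<and> t \<in> S \<and> f s ` attractor \<inter> f t ` attractor \<noteq> {}"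
    and e: "gap_free attractor e" "0 < e"
  shows "gap_free attractor (r * e)"
  unfolding gap_free_def
proof (intro allI impI)
  fix A assume A: "A \<subseteq> attractor" "\<forall>a\<in>A. \<forall>b\<in>attractor - A. r * e \<le> dist a b"
  have in_attractor: "f s x \<in> attractor" if "s \<in> S" "x \<in> attractor" for s x
    using attractor_fixed that by blast
  have cell: "f s ` attractor \<subseteq> A \<or> f s ` attractor \<inter> A = {}" if s: "s \<in> S" for s
  proof -
    define A' where "A' = {x \<in> attractor. f s x \<in> A}"
    have "e \<le> dist a b" if "a \<in> A'" "b \<in> attractor - A'" for a b
    proof -
      have "r * e \<le> dist (f s a) (f s b)"
        using that A in_attractor[OF s] by (auto simp: A'_def)
      then show ?thesis using ratio by (simp add: similitude_dist[OF simil[OF s]])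
    qed
    moreover have "A' \<subseteq> attractor" by (auto simp: A'_def)
    ultimately have "A' = {} \<or> A' = attractor"
      using e(1) unfolding gap_free_def by blast
    then show ?thesis by (auto simp: A'_def)
  qed
  have linked: "f t ` attractor \<subseteq> A" if "(s, t) \<in> E\<^sup>*" "f s ` attractor \<subseteq> A" for s t
    using that
  proof (induction rule: rtrancl_induct)
    case (step t u)
    then show ?case using meet[OF step(2)] cell[of u] by blast
  qed
  have empty: "A = {}" if "\<not> f s ` attractor \<subseteq> A" "s \<in> S" for s
  proof -
    have "\<not> f t ` attractor \<subseteq> A" if "t \<in> S" for t
      using \<open>\<not> f s ` attractor \<subseteq> A\<close> chain[OF \<open>t \<in> S\<close> \<open>s \<in> S\<close>] linked by blast
    then have "f t ` attractor \<inter> A = {}" if "t \<in> S" for t using cell that by blast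
    then show ?thesis using A(1) attractor_fixed by blast
  qed
  show "A = {} \<or> A = attractor"
  proof (cases "\<forall>s\<in>S. f s ` attractor \<subseteq> A")
    case True
    then show ?thesis using A(1) attractor_fixed by blast
  next
    case False
    then show ?thesis using empty by blast
  qed
qed

lemma connected_attractor:
  assumes "\<And>s t. s \<in> S \<Longrightarrow> t \<in> S \<Longrightarrow> (s, t) \<in> E\<^sup>*"
    and "\<And>s t. (s, t) \<in> E \<Longrightarrow> s \<in> S \<and> t \<in> S \<and> f s ` attractor \<inter> f t ` attractor \<noteq> {}"
  shows "connected attractor"
proof (rule connected_gap_free[OF compact_attractor])
  define d where "d = diameter attractor + 1"
  have bdd: "bounded attractor" using compact_attractor by (rule compact_imp_bounded)
  have d: "0 < d" using diameter_ge_0[OF bdd] by (simp add: d_def)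
  have gap: "gap_free attractor (r ^ n * d)" for n
  proof (induction n)
    case 0
    then show ?case using gap_free_diameter[OF bdd] by (simp add: d_def)
  next
    case (Suc n)
    have "0 < r ^ n * d" using d ratio by simp
    then show ?case
      using gap_free_shrink[OF assms Suc.IH] by (simp add: mult.assoc)
  qed
  fix e :: real assume "0 < e"
  then obtain n where "r ^ n * d < e"
    using power_times_small by blast
  then show "\<exists>e'\<le>e. gap_free attractor e'"
    using gap by (intro exI[of _ "r ^ n * d"]) auto
qed

end

section \<open>Neighbouring copies of the polygon\<close>

text \<open>Both vectors lie on the line orthogonal to \<open>d\<close>, on which only two points have a given
  norm.\<close>

lemma orthogonal_plane_eq_or_neg:
  fixes a b d :: "real^2"
  assumes "a \<bullet> d = 0" "b \<bullet> d = 0" "d \<noteq> 0" "a \<bullet> a = b \<bullet> b"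
  shows "a = b \<or> a = - b"
proof -
  obtain t where t: "(1 / norm d) *\<^sub>R d = dir t"
    using unit_vector_dir[of "(1 / norm d) *\<^sub>R d"] assms(3) by auto
  have "dir t \<bullet> x = 0" if "x \<bullet> d = 0" for x
    using that by (simp add: t[symmetric] inner_commute)
  then have frame: "x = (dir (t - pi/2) \<bullet> x) *\<^sub>R dir (t - pi/2)" if "x \<bullet> d = 0" for x
    using dir_frame[of x t] that by simp
  define \<alpha> \<beta> where "\<alpha> = dir (t - pi/2) \<bullet> a" and "\<beta> = dir (t - pi/2) \<bullet> b"
  have ab: "a = \<alpha> *\<^sub>R dir (t - pi/2)" "b = \<beta> *\<^sub>R dir (t - pi/2)"
    using frame assms(1,2) by (simp_all only: \<alpha>_def \<beta>_def)
  have "\<alpha>\<^sup>2 = \<beta>\<^sup>2"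
    using assms(4) unfolding ab by (simp add: inner_dir power2_eq_square)
  then have "\<alpha> = \<beta> \<or> \<alpha> = - \<beta>" by (simp add: power2_eq_iff)
  then show ?thesis unfolding ab by auto
qed

text \<open>The centres of the two copies are both at distance \<open>k\<close> from the midpoint of the common edge,
  perpendicularly to it. So either they are mirror images in that edge or they coincide; in the second case the common
  centre would belong to both copies, hence to the edge.\<close>

lemma mirrored_centre:
  assumes J: "3 \<le> J" and F: "similitude k F" and F': "similitude k F'"
    and inter: "F ` polygon J \<inter> F' ` polygon J \<subseteq> F ` edge J i"
    and edges: "F ` edge J i = F' ` edge J j"
  shows "F (reflect_in (affine hull (edge J i)) 0) = F' 0"
proof -
  let ?n = "apothem J i" and ?m = "apothem J j"
  have k: "0 < k" using F by (simp add: similitude_def)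
  have ends: "{F (vertex J (i - 1)), F (vertex J i)} = {F' (vertex J (j - 1)), F' (vertex J j)}"
    using edges unfolding edge_def similitude_image_segment[OF F] similitude_image_segment[OF F']
    by simp
  have mid: "F ?n = F' ?m"
    using ends unfolding apothem_midpoint[OF J] similitude_midpoint[OF F] similitude_midpoint[OF F']
    by (auto simp: doubleton_eq_iff midpoint_sym)
  \<comment> \<open>\<open>d\<close> runs along the common edge; \<open>a\<close> and \<open>b\<close> lead from its midpoint to the mirror image of the
    first centre and to the second centre.\<close>
  define d where "d = F (vertex J i) - F (vertex J (i - 1))"
  define a b where "a = F (2 *\<^sub>R ?n) - F ?n" and "b = F' 0 - F' ?m"
  have d: "d = F' (vertex J j) - F' (vertex J (j - 1)) \<or> d = F' (vertex J (j - 1)) - F' (vertex J j)"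
    using ends by (auto simp: d_def doubleton_eq_iff)
  have "d \<noteq> 0"
    using edge_ends_distinct[OF J, of i] similitude_inj[OF F] by (auto simp: d_def inj_def)
  have "a \<bullet> d = 0"
    using apothem_orthogonal_edge[OF J, of i]
    by (simp add: a_def d_def similitude_inner_diff[OF F] scaleR_2)
  have "b \<bullet> d = 0"
  proof -
    have "b \<bullet> (F' (vertex J j) - F' (vertex J (j - 1))) = 0"
      using apothem_orthogonal_edge[OF J, of j] by (simp add: b_def similitude_inner_diff[OF F'])
    then show ?thesis using d by (auto simp: inner_diff_right)
  qed
  have "a \<bullet> a = b \<bullet> b"
    by (simp add: a_def b_def similitude_inner_diff[OF F] similitude_inner_diff[OF F'] scaleR_2)
  have "midpoint (F 0) (F (2 *\<^sub>R ?n)) = F ?n"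
    by (subst similitude_midpoint[OF F, symmetric]) (simp add: midpoint_def)
  then have "F 0 + F (2 *\<^sub>R ?n) = F ?n + F ?n"
    by (simp only: midpoint_eq_iff)
  then have refl: "F ?n - F 0 = a"
    by (simp only: a_def eq_diff_eq add_diff_eq diff_eq_eq diff_add_eq add.commute)
  have "a = b"
  proof (rule ccontr)
    assume "a \<noteq> b"
    then have "a = - b"
      using orthogonal_plane_eq_or_neg \<open>a \<bullet> d = 0\<close> \<open>b \<bullet> d = 0\<close> \<open>d \<noteq> 0\<close> \<open>a \<bullet> a = b \<bullet> b\<close> by blast
    then have "F 0 = F' 0"
      using refl mid by (simp add: b_def algebra_simps)
    moreover have "0 \<in> polygon J"
      using zero_in_interior_polygon[OF J] interior_subset by blast
    ultimately have "F 0 \<in> F ` polygon J \<inter> F' ` polygon J" by (metis IntI imageI)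
    then have "F 0 \<in> F ` edge J i" using inter by blast
    then have "0 \<in> edge J i"
      using similitude_inj[OF F] by (simp add: inj_image_mem_iff)
    then show False using zero_not_in_edge[OF J] by blast
  qed
  moreover have "reflect_in (affine hull (edge J i)) 0 = 2 *\<^sub>R ?n"
    by (simp add: reflect_in_edge[OF J])
  ultimately show ?thesis
    using mid by (simp add: a_def b_def)
qed

section \<open>Symmetric polygon systems\<close>

lemma group_O2: "group O2"
proof (rule groupI)
  fix x assume "x \<in> carrier O2"
  then have "orthogonal_transformation x" by (simp add: O2_def)
  then show "\<exists>y\<in>carrier O2. y \<otimes>\<^bsub>O2\<^esub> x = \<one>\<^bsub>O2\<^esub>"
    using orthogonal_transformation_inv[of x] orthogonal_transformation_inj[of x]
    by (intro bexI[of _ "Hilbert_Choice.inv x"]) (simp_all add: O2_def)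
qed (auto simp: O2_def comp_assoc orthogonal_transformation_compose id_def)

lemma D_ext_orthogonal:
  assumes "g \<in> D_ext J"
  shows "orthogonal_transformation g"
proof -
  have "D_set J \<union> range (\<lambda>i. reflect_dir (rho J i)) \<subseteq> carrier O2"
    using orthogonal_reflect_dir by (auto simp: O2_def D_set_def)
  then have "g \<in> carrier O2"
    using group.generate_in_carrier[OF group_O2] assms unfolding D_ext_def by blast
  then show ?thesis by (simp add: O2_def)
qed

lemma reflect_in_self:
  assumes "closed L" "x \<in> L"
  shows "reflect_in L x = x"
  using assms closest_point_self[of x L] by (simp add: reflect_in_def scaleR_2)

text \<open>The ratio, the isometries and the translations, which \<open>ss_system\<close> quantifies existentially,
  become parameters, so that the lemmas can speak about them.\<close>

locale gon_system =
  fixes J :: nat and G :: "(real^2 \<Rightarrow> real^2) set" and S :: "'s set"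
    and f :: "'s \<Rightarrow> real^2 \<Rightarrow> real^2" and r :: real and \<phi> :: "'s \<Rightarrow> real^2 \<Rightarrow> real^2"
    and c :: "'s \<Rightarrow> real^2"
  assumes J: "3 \<le> J" and G_symmetries: "G \<subseteq> D_set J"
    and finite_letters: "finite S" and ratio_bounds: "0 < r" "r < 1"
    and orthogonal_\<phi>: "s \<in> S \<Longrightarrow> orthogonal_transformation (\<phi> s)"
    and f_eq: "s \<in> S \<Longrightarrow> f s x = r *\<^sub>R \<phi> s x + c s"
    and f_nested: "s \<in> S \<Longrightarrow> f s ` polygon J \<subseteq> polygon J"
    and edge_covered: "\<exists>s\<in>S. \<exists>j. f s ` edge J j \<subseteq> edge J i"
    and G_permutes: "g \<in> G \<Longrightarrow> \<exists>h\<in>S \<rightarrow> S. \<forall>s\<in>S. Hilbert_Choice.inv (f (h s)) \<circ> g \<circ> f s \<in> G"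
    and meeting: "\<lbrakk>s \<in> S; t \<in> S; s \<noteq> t; f s ` polygon J \<inter> f t ` polygon J \<noteq> {}\<rbrakk>
      \<Longrightarrow> meet_at_edge J G f \<phi> s t \<or> meet_at_vertex J f s t"
    and linked: "\<lbrakk>s \<in> S; t \<in> S\<rbrakk>
      \<Longrightarrow> (s, t) \<in> (edge_adjacency J G S f \<phi> \<union> (edge_adjacency J G S f \<phi>)\<inverse>)\<^sup>*"

lemma ss_system_gon_system:
  assumes "3 \<le> J" "ss_system J G S f"
  obtains r \<phi> c where "gon_system J G S f r \<phi> c"
proof -
  from assms(2) have G: "subgroup G (D_group J)" and fin: "finite S"
    by (simp_all add: ss_system_def)
  from G have G: "G \<subseteq> D_set J" by (auto simp: subgroup_def D_group_def)
  from assms(2) obtain r \<phi> c where sys: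
    "0 < r" "r < 1"
    "\<forall>s\<in>S. \<phi> s \<in> D_ext J \<and> (\<forall>x. f s x = r *\<^sub>R \<phi> s x + c s) \<and> f s ` polygon J \<subseteq> polygon J"
    "\<forall>i. \<exists>s\<in>S. \<exists>j. f s ` edge J j \<subseteq> edge J i"
    "\<forall>g\<in>G. \<exists>h\<in>S \<rightarrow> S. \<forall>s\<in>S. Hilbert_Choice.inv (f (h s)) \<circ> g \<circ> f s \<in> G"
    "\<forall>s\<in>S. \<forall>s'\<in>S. s \<noteq> s' \<and> f s ` polygon J \<inter> f s' ` polygon J \<noteq> {} \<longrightarrow>
              meet_at_edge J G f \<phi> s s' \<or> meet_at_vertex J f s s'"
    "\<forall>s\<in>S. \<forall>s'\<in>S. (s, s') \<in> (edge_adjacency J G S f \<phi> \<union> (edge_adjacency J G S f \<phi>)\<inverse>)\<^sup>*"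
    unfolding ss_system_def by (elim conjE exE) (rule that)
  have "gon_system J G S f r \<phi> c"
  proof
    show "3 \<le> J" "G \<subseteq> D_set J" "finite S" "0 < r" "r < 1" by fact+
    show "orthogonal_transformation (\<phi> s)" if "s \<in> S" for s
      using sys(3) that D_ext_orthogonal by blast
    show "f s x = r *\<^sub>R \<phi> s x + c s" if "s \<in> S" for s x using sys(3) that by blast
    show "f s ` polygon J \<subseteq> polygon J" if "s \<in> S" for s using sys(3) that by blast
    show "\<exists>s\<in>S. \<exists>j. f s ` edge J j \<subseteq> edge J i" for i using sys(4) ..
    show "\<exists>h\<in>S \<rightarrow> S. \<forall>s\<in>S. Hilbert_Choice.inv (f (h s)) \<circ> g \<circ> f s \<in> G" if "g \<in> G" for g
      using sys(5) that ..
    show "meet_at_edge J G f \<phi> s t \<or> meet_at_vertex J f s t"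
      if "s \<in> S" "t \<in> S" "s \<noteq> t" "f s ` polygon J \<inter> f t ` polygon J \<noteq> {}" for s t
      using sys(6)[rule_format, OF that(1,2)] that(3,4) by simp
    show "(s, t) \<in> (edge_adjacency J G S f \<phi> \<union> (edge_adjacency J G S f \<phi>)\<inverse>)\<^sup>*"
      if "s \<in> S" "t \<in> S" for s t
      using sys(7)[rule_format, OF that] .
  qed
  then show thesis by (rule that)
qed

context gon_system
begin

lemma similitude_letter: "s \<in> S \<Longrightarrow> similitude r (f s)"
  unfolding similitude_def using ratio_bounds orthogonal_\<phi> f_eq by blast

sublocale nested_similitudes S f r "polygon J"
proof
  show "S \<noteq> {}" using edge_covered[of 0] by blast
  show "polygon J \<noteq> {}" using vertex_in_polygon[OF J] by blast
qed (use finite_letters ratio_bounds similitude_letter compact_polygon[OF J] f_nested in blast)+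

lemma G_fixes_0: "g \<in> G \<Longrightarrow> g 0 = 0"
  using G_symmetries by (auto simp: D_set_def orthogonal_transformation_def intro: linear_0)

text \<open>Each edge contains an edge of a first-level cell, which contains an edge of a second-level cell, and so
  on; thus every level has a cell that touches the given edge.\<close>

lemma edge_covered_word: "\<exists>w\<in>words n. \<exists>j. word_map f w ` edge J j \<subseteq> edge J i"
proof (induction n arbitrary: i)
  case 0
  then show ?case by auto
next
  case (Suc n)
  obtain s k where s: "s \<in> S" "f s ` edge J k \<subseteq> edge J i" using edge_covered by blast
  obtain w j where w: "w \<in> words n" "word_map f w ` edge J j \<subseteq> edge J k" using Suc by blast
  have "s # w \<in> words (Suc n)" using s(1) w(1) by (auto simp: words_Suc)
  moreover have "word_map f (s # w) ` edge J j \<subseteq> edge J i"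
    using s(2) w(2) by (auto simp: image_subset_iff)
  ultimately show ?case by blast
qed

lemma attractor_meets_edge: "attractor \<inter> edge J i \<noteq> {}"
proof (rule attractor_meets)
  show "closed (edge J i)" by (simp add: edge_def)
  fix n
  obtain w j where w: "w \<in> words n" "word_map f w ` edge J j \<subseteq> edge J i"
    using edge_covered_word by blast
  moreover have "vertex J j \<in> edge J j" "vertex J j \<in> polygon J"
    using vertex_in_edge vertex_in_polygon[OF J] J by blast+
  ultimately show "\<exists>w\<in>words n. word_map f w ` polygon J \<inter> edge J i \<noteq> {}" by blast
qed

section \<open>Cells determine their words\<close>

abbreviation "cell w \<equiv> word_map f w ` polygon J"
abbreviation "core w \<equiv> word_map f w ` interior (polygon J)"

lemma core_interior: "w \<in> lists S \<Longrightarrow> core w = interior (cell w)"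
  using similitude_word similitude_interior by blast

text \<open>Interiors nest like cells do. This is what separates words: closed cells may share boundary points, but
  interiors of cells of the same level cannot meet unless the words agree.\<close>

lemma core_append:
  assumes v: "v \<in> lists S"
  shows "core (w @ v) \<subseteq> core w"
proof -
  have "core (w @ v) = word_map f w ` core v" by (simp add: word_map_append image_comp)
  also have "\<dots> \<subseteq> core w"
    unfolding core_interior[OF v] by (intro image_mono interior_mono cell_subset v)
  finally show ?thesis .
qed

text \<open>At the first letter where the words differ, the two cells lie in first-level cells of a copy of the
  system, which share at most an edge; and an edge is disjoint from the interior of the polygon.\<close>

lemma cores_disjoint:
  assumes "w \<in> lists S" "v \<in> lists S" "length w = length v" "w \<noteq> v"
  shows "core w \<inter> core v = {}"
  using assms
proof (induction w arbitrary: v rule: list.induct)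
  case Nil
  then show ?case by simp
next
  case (Cons s w)
  then obtain t v' where v: "v = t # v'" "length w = length v'" "t \<in> S" "v' \<in> lists S"
    by (cases v) auto
  have s: "s \<in> S" "w \<in> lists S" using Cons.prems by auto
  show ?case
  proof (cases "s = t")
    case True
    then have "core w \<inter> core v' = {}" using Cons v s by auto
    then have "f s ` core w \<inter> f s ` core v' = {}"
      using similitude_inj[OF similitude_letter[OF s(1)]] by (metis image_Int image_empty)
    then show ?thesis using True by (simp add: v(1) image_comp)
  next
    case False
    show ?thesis
    proof (rule ccontr)
      assume "core (s # w) \<inter> core v \<noteq> {}"
      then obtain a b where ab: "a \<in> interior (polygon J)" "b \<in> interior (polygon J)"
          "f s (word_map f w a) = f t (word_map f v' b)"
        by (auto simp: v(1))
      define y z where "y = word_map f w a" and "z = word_map f v' b"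
      have "core w \<subseteq> interior (polygon J)" "core v' \<subseteq> interior (polygon J)"
        using core_append[of w "[]"] core_append[of v' "[]"] s v by simp_all
      then have y: "y \<in> interior (polygon J)" "z \<in> interior (polygon J)" "f s y = f t z"
        using ab by (auto simp: y_def z_def)
      then have x: "f s y \<in> f s ` polygon J \<inter> f t ` polygon J"
        using interior_subset by (metis IntI imageI subsetD)
      then have "meet_at_edge J G f \<phi> s t \<or> meet_at_vertex J f s t"
        using meeting s v False by blast
      then obtain i where "f s y \<in> f s ` edge J i"
        using x vertex_in_edge[OF J] unfolding meet_at_edge_def meet_at_vertex_def by blast
      then have "y \<in> edge J i"
        using similitude_inj[OF similitude_letter[OF s(1)]] by (simp add: inj_image_mem_iff)
      then show False using edge_interior_disjoint[OF J] y(1) by blast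
    qed
  qed
qed

lemma core_nonempty: "core w \<noteq> {}"
  using zero_in_interior_polygon[OF J] by blast

lemma same_centre:
  assumes "w \<in> lists S" "v \<in> lists S" "length w = length v" "word_map f w 0 = word_map f v 0"
  shows "w = v"
proof (rule ccontr)
  assume "w \<noteq> v"
  then have "core w \<inter> core v = {}" using cores_disjoint assms by blast
  then show False
    using zero_in_interior_polygon[OF J] assms(4) by (metis disjoint_iff imageI)
qed

text \<open>If \<open>v\<close> did not begin with \<open>w\<close>, the interior of \<open>Q\<^sub>v\<close> would
  lie in the interiors of two cells of the level of \<open>w\<close> with different words.\<close>

lemma subcell_prefix:
  assumes "w \<in> lists S" "v \<in> lists S" "length w \<le> length v" "cell v \<subseteq> cell w"
  shows "take (length w) v = w"
proof (rule ccontr)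
  let ?t = "take (length w) v" and ?d = "drop (length w) v"
  have t: "?t \<in> lists S" "?d \<in> lists S"
    using assms(2) by (auto dest: in_set_takeD in_set_dropD)
  assume "?t \<noteq> w"
  then have "core ?t \<inter> core w = {}" using cores_disjoint[of ?t w] t assms by simp
  moreover have "core v \<subseteq> core ?t" using core_append[of ?d ?t] t by simp
  moreover have "core v \<subseteq> core w"
    using assms interior_mono[of "cell v" "cell w"] by (simp add: core_interior)
  ultimately show False using core_nonempty[of v] by blast
qed

lemma cell_inj:
  assumes "w \<in> lists S" "v \<in> lists S" "length w = length v" "cell w = cell v"
  shows "w = v"
  using subcell_prefix[of w v] assms by simp

section \<open>Symmetries permute cells\<close>

lemma star_word_eqI:
  assumes "v \<in> lists S" "length v = length w" "g ` cell w = cell v"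
  shows "star_word J S f g w = v"
  unfolding star_word_def
proof (rule the_equality)
  show "v \<in> lists S \<and> length v = length w \<and> g ` cell w = cell v" using assms by blast
  fix v' assume "v' \<in> lists S \<and> length v' = length w \<and> g ` cell w = cell v'"
  then show "v' = v" using assms by (intro cell_inj) auto
qed

lemma star_word:
  assumes "g \<in> G_star J S f" "w \<in> lists S"
  shows "star_word J S f g w \<in> lists S" "length (star_word J S f g w) = length w"
    "g ` cell w = cell (star_word J S f g w)"
proof -
  obtain v where "v \<in> lists S" "length v = length w" "g ` cell w = cell v"
    using assms unfolding G_star_def by blast
  then show "star_word J S f g w \<in> lists S" "length (star_word J S f g w) = length w"
    "g ` cell w = cell (star_word J S f g w)"
    using star_word_eqI[of v w g] by simp_all
qed

lemma G_star_bij: "g \<in> G_star J S f \<Longrightarrow> bij g"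
  by (simp add: G_star_def D_set_def orthogonal_transformation_bij)

text \<open>A symmetry in \<open>G\<^sub>*\<close> is injective, so it permutes the finitely many cells of each level;
  in particular its inverse is in \<open>G\<^sub>*\<close> as well.\<close>

lemma star_word_surj:
  assumes "g \<in> G_star J S f"
  shows "star_word J S f g ` words n = words n"
proof (rule endo_inj_surj[OF finite_words])
  show "star_word J S f g ` words n \<subseteq> words n"
    using star_word[OF assms] by (auto simp: words_def)
  show "inj_on (star_word J S f g) (words n)"
  proof (rule inj_onI)
    fix w v assume wv: "w \<in> words n" "v \<in> words n" "star_word J S f g w = star_word J S f g v"
    then have "g ` cell w = g ` cell v"
      using star_word(3)[OF assms, of w] star_word(3)[OF assms, of v] by (simp add: words_def)
    then have "cell w = cell v"
      using G_star_bij[OF assms] by (metis bij_is_inj inj_image_eq_iff)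
    then show "w = v" using cell_inj wv by (auto simp: words_def)
  qed
qed

lemma inv_G_star:
  assumes g: "g \<in> G_star J S f"
  shows "Hilbert_Choice.inv g \<in> G_star J S f"
proof -
  have inj: "Hilbert_Choice.inv g ` g ` X = X" for X
    using G_star_bij[OF g] by (simp add: bij_is_inj image_inv_f_f)
  have "orthogonal_transformation (Hilbert_Choice.inv g)" "g ` polygon J = polygon J"
    using g by (auto simp: G_star_def D_set_def orthogonal_transformation_inv)
  moreover have "\<exists>v\<in>lists S. length v = length w \<and> Hilbert_Choice.inv g ` cell w = cell v"
    if "w \<in> lists S" for w
  proof -
    have "w \<in> words (length w)" using that by (simp add: words_def)
    then have "w \<in> star_word J S f g ` words (length w)"
      using star_word_surj[OF g, of "length w"] by simp
    then obtain v where v: "v \<in> words (length w)" "star_word J S f g v = w"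
      by (elim imageE) simp
    then have "cell w = g ` cell v"
      using star_word(3)[OF g, of v] by (simp add: words_def)
    then show ?thesis using v(1) inj by (auto simp: words_def)
  qed
  ultimately show ?thesis
    using inj[of "polygon J"] unfolding G_star_def D_set_def by auto
qed

text \<open>Cells below \<open>Q\<^sub>w\<close> go to cells inside \<open>g(Q\<^sub>w)\<close>, and
  \<open>subcell_prefix\<close> forces their words to extend \<open>g\<^sub>*(w)\<close>. Now
  \<open>attractor_cell_iff\<close> turns this into a statement about the attractor.\<close>

lemma G_star_attractor_subset:
  assumes g: "g \<in> G_star J S f" and w: "w \<in> lists S"
  shows "g ` word_map f w ` attractor \<subseteq> word_map f (star_word J S f g w) ` attractor"
proof
  let ?v = "star_word J S f g w"
  fix y assume "y \<in> g ` word_map f w ` attractor"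
  then obtain x where x: "x \<in> word_map f w ` attractor" "y = g x" by blast
  have "\<exists>u\<in>words n. y \<in> cell (?v @ u)" for n
  proof -
    obtain u where u: "u \<in> words n" "x \<in> cell (w @ u)"
      using x(1) attractor_cell_iff[OF w] by blast
    then have wu: "w @ u \<in> lists S" "u \<in> lists S" "length u = n" using w by (auto simp: words_def)
    let ?z = "star_word J S f g (w @ u)"
    have z: "?z \<in> lists S" "length ?z = length w + n" "g ` cell (w @ u) = cell ?z"
      using star_word[OF g wu(1)] wu(3) by simp_all
    have "cell ?z \<subseteq> cell ?v"
      using cell_append[OF wu(2), of w] star_word(3)[OF g w] z(3) by blast
    then have "take (length ?v) ?z = ?v"
      using star_word[OF g w] z by (intro subcell_prefix) auto
    then have "?z = ?v @ drop (length ?v) ?z" by (metis append_take_drop_id)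
    moreover have "drop (length ?v) ?z \<in> words n"
      using z star_word(2)[OF g w] by (auto simp: words_def dest: in_set_dropD)
    moreover have "y \<in> cell ?z" using u(2) x(2) z(3) by blast
    ultimately show ?thesis by metis
  qed
  then show "y \<in> word_map f ?v ` attractor"
    using attractor_cell_iff[OF star_word(1)[OF g w]] by blast
qed

lemma G_star_attractor:
  assumes g: "g \<in> G_star J S f" and w: "w \<in> lists S"
  shows "g ` word_map f w ` attractor = word_map f (star_word J S f g w) ` attractor"
proof (rule antisym[OF G_star_attractor_subset[OF assms]])
  let ?v = "star_word J S f g w" and ?h = "Hilbert_Choice.inv g"
  have "?h ` cell ?v = cell w"
    using star_word(3)[OF assms, symmetric] G_star_bij[OF g] by (simp add: bij_is_inj image_inv_f_f)
  then have "star_word J S f ?h ?v = w"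
    using w star_word(2)[OF assms] by (intro star_word_eqI) auto
  then have "?h ` word_map f ?v ` attractor \<subseteq> word_map f w ` attractor"
    using G_star_attractor_subset[OF inv_G_star[OF g] star_word(1)[OF assms]] by simp
  then have "g ` ?h ` word_map f ?v ` attractor \<subseteq> g ` word_map f w ` attractor"
    by (rule image_mono)
  then show "word_map f ?v ` attractor \<subseteq> g ` word_map f w ` attractor"
    using G_star_bij[OF g] by (simp add: bij_is_surj image_f_inv_f)
qed

text \<open>The symmetry is pushed through the letters one at a time: \<open>g \<circ> f\<^sub>s = f\<^sub>t \<circ>
  g'\<close> with \<open>g'\<close> again in \<open>G\<close>. The residual symmetry at the end of the word is what
  later identifies \<open>(f\<^sub>v)\<^sup>-\<^sup>1 \<circ> R \<circ> f\<^sub>w\<close>.\<close>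

lemma G_transport:
  assumes "g \<in> G" "w \<in> lists S"
  shows "\<exists>v\<in>lists S. length v = length w \<and> (\<exists>g'\<in>G. g \<circ> word_map f w = word_map f v \<circ> g')"
  using assms
proof (induction w arbitrary: g)
  case Nil
  then show ?case by auto
next
  case (Cons s w)
  then have s: "s \<in> S" "w \<in> lists S" by auto
  obtain h where h: "h \<in> S \<rightarrow> S" "\<forall>s\<in>S. Hilbert_Choice.inv (f (h s)) \<circ> g \<circ> f s \<in> G"
    using G_permutes[OF Cons.prems(1)] by blast
  define g\<^sub>1 where "g\<^sub>1 = Hilbert_Choice.inv (f (h s)) \<circ> g \<circ> f s"
  have hs: "h s \<in> S" "g\<^sub>1 \<in> G" using h s by (auto simp: g\<^sub>1_def)
  have "surj (f (h s))"
    using similitude_bij[OF similitude_letter[OF hs(1)]] by (rule bij_is_surj)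
  then have step: "g \<circ> f s = f (h s) \<circ> g\<^sub>1"
    by (simp add: g\<^sub>1_def fun_eq_iff surj_f_inv_f)
  obtain v g' where v: "v \<in> lists S" "length v = length w" "g' \<in> G"
      "g\<^sub>1 \<circ> word_map f w = word_map f v \<circ> g'"
    using Cons.IH[OF hs(2) s(2)] by blast
  have "g \<circ> word_map f (s # w) = (g \<circ> f s) \<circ> word_map f w" by (simp add: comp_assoc)
  also have "\<dots> = f (h s) \<circ> (g\<^sub>1 \<circ> word_map f w)" by (simp only: step comp_assoc)
  also have "\<dots> = word_map f (h s # v) \<circ> g'" by (simp only: v(4) word_map.simps comp_assoc)
  finally have "g \<circ> word_map f (s # w) = word_map f (h s # v) \<circ> g'" .
  moreover have "h s # v \<in> lists S" "length (h s # v) = length (s # w)" using v hs(1) by auto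
  ultimately show ?case using v(3) by blast
qed

lemma G_subset_G_star: "G \<subseteq> G_star J S f"
proof
  fix g assume g: "g \<in> G"
  have "\<exists>v\<in>lists S. length v = length w \<and> g ` cell w = cell v" if w: "w \<in> lists S" for w
  proof -
    obtain v g' where v: "v \<in> lists S" "length v = length w" "g' \<in> G" "g \<circ> word_map f w = word_map f v \<circ> g'"
      using G_transport[OF g w] by blast
    have "g' ` polygon J = polygon J" using v(3) G_symmetries by (auto simp: D_set_def)
    then have "g ` cell w = cell v" using v(4) by (metis image_comp)
    then show ?thesis using v by blast
  qed
  then show "g \<in> G_star J S f" using g G_symmetries unfolding G_star_def by blast
qed

section \<open>Reflections in common edges\<close>

lemma edge_line_nonempty: "affine hull (edge J i) \<noteq> {}"
  using vertex_in_edge[OF J, of i] hull_inc by fast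

lemma reflect_in_image_edge:
  assumes "similitude k F"
  shows "reflect_in (affine hull (F ` edge J i)) (F x) = F (reflect_in (affine hull (edge J i)) x)"
  using reflect_in_similitude[OF assms affine_affine_hull edge_line_nonempty]
  by (simp add: similitude_image_affine_hull[OF assms])

text \<open>The system axiom only says that the linear part of \<open>(f\<^sub>t)\<^sup>-\<^sup>1 \<circ> R \<circ>
  f\<^sub>s\<close> is in \<open>G\<close>. Its translation part vanishes because \<open>R\<close> exchanges the centres
  of the two cells (\<open>mirrored_centre\<close>).\<close>

lemma letter_reflection:
  assumes st: "s \<in> S" "t \<in> S"
    and inter: "f s ` polygon J \<inter> f t ` polygon J = f s ` edge J i"
    and edges: "f s ` edge J i = f t ` edge J j"
    and G: "Hilbert_Choice.inv (\<phi> t) \<circ> \<phi> s \<circ> reflect_dir (rho J i) \<in> G"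
  shows "reflect_in (affine hull (f s ` edge J i)) \<circ> f s
    = f t \<circ> (Hilbert_Choice.inv (\<phi> t) \<circ> \<phi> s \<circ> reflect_dir (rho J i))"
proof
  fix x
  note sim = similitude_letter[OF st(1)] similitude_letter[OF st(2)]
  let ?n = "2 *\<^sub>R apothem J i"
  have lin: "linear (\<phi> s)" "linear (\<phi> t)"
    using orthogonal_\<phi> st by (simp_all add: orthogonal_transformation_def)
  have "f s (reflect_in (affine hull (edge J i)) 0) = f t 0"
    using mirrored_centre[OF J sim _ edges] inter by simp
  then have centre: "r *\<^sub>R \<phi> s ?n + c s = c t"
    using lin st by (simp add: f_eq reflect_in_edge[OF J] linear_0)
  have "reflect_in (affine hull (edge J i)) x = reflect_dir (rho J i) x + ?n"
    by (simp add: reflect_in_edge[OF J] reflect_dir_rho scaleR_diff_left right_diff_distrib)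
  then have "reflect_in (affine hull (f s ` edge J i)) (f s x) = f s (reflect_dir (rho J i) x + ?n)"
    by (simp add: reflect_in_image_edge[OF sim(1)])
  also have "\<dots> = r *\<^sub>R \<phi> s (reflect_dir (rho J i) x) + (r *\<^sub>R \<phi> s ?n + c s)"
    using st by (simp add: f_eq linear_add[OF lin(1)] scaleR_add_right)
  also have "\<dots> = f t (Hilbert_Choice.inv (\<phi> t) (\<phi> s (reflect_dir (rho J i) x)))"
    using st orthogonal_transformation_surj[OF orthogonal_\<phi>[OF st(2)]]
    unfolding centre by (simp add: f_eq surj_f_inv_f)
  finally show "(reflect_in (affine hull (f s ` edge J i)) \<circ> f s) x
    = (f t \<circ> (Hilbert_Choice.inv (\<phi> t) \<circ> \<phi> s \<circ> reflect_dir (rho J i))) x"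
    by simp
qed

text \<open>An edge contained in another one is a nondegenerate segment, so it spans the same line.\<close>

lemma edge_line_unique:
  assumes "similitude k F" "similitude l F'" "F ` edge J i \<subseteq> F' ` edge J j"
  shows "affine hull (F ` edge J i) = affine hull (F' ` edge J j)"
proof -
  have dim: "aff_dim (F ` edge J i) = 1" if "similitude k F" for k F i
  proof -
    have "F (vertex J (i - 1)) \<noteq> F (vertex J i)"
      using similitude_inj[OF that] edge_ends_distinct[OF J, of i] by (auto dest: injD)
    moreover have "F ` edge J i = convex hull {F (vertex J (i - 1)), F (vertex J i)}"
      unfolding edge_def similitude_image_segment[OF that] by (rule segment_convex_hull)
    ultimately show ?thesis by (simp add: aff_dim_convex_hull)
  qed
  then show ?thesis
    using aff_dim_eq_full_gen[OF assms(3)] assms(1,2) by metis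
qed

text \<open>A common first letter can be stripped, since similitudes transport reflections. If the first letters
  \<open>s\<close> and \<open>t\<close> differ, the common edge lies in the common edge of their cells, so
  \<open>R\<close> is the reflection for \<open>s\<close> and \<open>t\<close>, and \<open>G_transport\<close> gives
  \<open>R \<circ> f\<^sub>w = f\<^bsub>tx\<^esub> \<circ> g\<close> for some word \<open>x\<close>. It remains to see
  that \<open>tx = v\<close>: the reflected cell has its centre where \<open>Q\<^sub>v\<close> has it
  (\<open>mirrored_centre\<close> for words), and cells of one level with the same centre have the same word.\<close>

lemma word_reflection:
  assumes "w \<in> lists S" "v \<in> lists S" "length w = length v"
    and "cell w \<inter> cell v = word_map f w ` edge J i"
    and "word_map f w ` edge J i = word_map f v ` edge J j"
  shows "\<exists>g\<in>G. reflect_in (affine hull (word_map f w ` edge J i)) \<circ> word_map f w = word_map f v \<circ> g"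
  using assms
proof (induction w arbitrary: v rule: list.induct)
  case Nil
  then have "polygon J = edge J i" by simp
  moreover have "0 \<in> polygon J"
    using zero_in_interior_polygon[OF J] interior_subset by blast
  ultimately show ?case using zero_not_in_edge[OF J] by blast
next
  case (Cons s w)
  then obtain t v' where v: "v = t # v'" "length w = length v'" "t \<in> S" "v' \<in> lists S"
    by (cases v) auto
  have s: "s \<in> S" "w \<in> lists S" using Cons.prems by auto
  note sim_s = similitude_letter[OF s(1)]
  note sim_w = similitude_word[OF Cons.prems(1)]
  note inj_s = similitude_inj[OF sim_s]
  define R where "R = reflect_in (affine hull (word_map f (s # w) ` edge J i))"
  have img: "word_map f (a # u) ` X = f a ` word_map f u ` X" for a u X
    by (simp add: image_comp)
  show ?case
  proof (cases "s = t")
    case True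
    have "f s ` (cell w \<inter> cell v') = f s ` word_map f w ` edge J i"
      using Cons.prems(4) by (simp only: v(1) True[symmetric] img image_Int[OF inj_s])
    then have 1: "cell w \<inter> cell v' = word_map f w ` edge J i"
      using inj_s by (simp add: inj_image_eq_iff)
    have "f s ` word_map f w ` edge J i = f s ` word_map f v' ` edge J j"
      using Cons.prems(5) by (simp only: v(1) True[symmetric] img)
    then have 2: "word_map f w ` edge J i = word_map f v' ` edge J j"
      using inj_s by (simp add: inj_image_eq_iff)
    obtain g where g: "g \<in> G"
      "reflect_in (affine hull (word_map f w ` edge J i)) \<circ> word_map f w = word_map f v' \<circ> g"
      using Cons.IH[OF s(2) v(4) v(2) 1 2] by blast
    have "(R \<circ> word_map f (s # w)) x = (word_map f v \<circ> g) x" for x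
    proof -
      have "R (f s (word_map f w x)) = f s (word_map f w (reflect_in (affine hull (edge J i)) x))"
        using reflect_in_image_edge[OF sim_w, of i x] by (simp add: R_def)
      also have "\<dots> = f s (reflect_in (affine hull (word_map f w ` edge J i)) (word_map f w x))"
        using reflect_in_image_edge[OF similitude_word[OF s(2)]] by simp
      also have "\<dots> = f s (word_map f v' (g x))"
        using g(2) by (simp add: fun_eq_iff)
      finally show ?thesis using True by (simp add: v(1))
    qed
    then show ?thesis using g(1) by (auto simp: R_def)
  next
    case False
    have "cell (s # w) \<subseteq> f s ` polygon J" "cell v \<subseteq> f t ` polygon J"
      unfolding v(1) img by (intro image_mono cell_subset s v(4))+
    then have inter: "word_map f (s # w) ` edge J i \<subseteq> f s ` polygon J \<inter> f t ` polygon J"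
      unfolding Cons.prems(4)[symmetric] by (rule Int_mono)
    have ends: "word_map f (s # w) (vertex J i) \<in> word_map f (s # w) ` edge J i"
      "word_map f (s # w) (vertex J (i - 1)) \<in> word_map f (s # w) ` edge J i"
      by (simp_all add: edge_def)
    have distinct: "word_map f (s # w) (vertex J i) \<noteq> word_map f (s # w) (vertex J (i - 1))"
      using similitude_inj[OF sim_w] edge_ends_distinct[OF J, of i] by (metis injD)
    have "f s ` polygon J \<inter> f t ` polygon J \<noteq> {x}" for x
      using subsetD[OF inter ends(1)] subsetD[OF inter ends(2)] distinct by (metis singletonD)
    then have "\<not> meet_at_vertex J f s t"
      by (simp add: meet_at_vertex_def)
    moreover have "f s ` polygon J \<inter> f t ` polygon J \<noteq> {}" using inter ends by blast
    ultimately have "meet_at_edge J G f \<phi> s t"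
      using meeting s(1) v(3) False by blast
    then obtain k l where kl: "f s ` polygon J \<inter> f t ` polygon J = f s ` edge J k"
      "f s ` edge J k = f t ` edge J l"
      "Hilbert_Choice.inv (\<phi> t) \<circ> \<phi> s \<circ> reflect_dir (rho J k) \<in> G"
      unfolding meet_at_edge_def by blast
    define h where "h = Hilbert_Choice.inv (\<phi> t) \<circ> \<phi> s \<circ> reflect_dir (rho J k)"
    \<comment> \<open>The small common edge lies in the common edge of the first-level cells.\<close>
    have "R = reflect_in (affine hull (f s ` edge J k))"
      using edge_line_unique[OF sim_w sim_s] inter kl(1) by (simp add: R_def)
    then have Rs: "R \<circ> f s = f t \<circ> h" "h \<in> G"
      using letter_reflection[OF s(1) v(3) kl] kl(3) by (simp_all add: h_def)
    obtain x g where x: "x \<in> lists S" "length x = length w" "g \<in> G" "h \<circ> word_map f w = word_map f x \<circ> g"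
      using G_transport[OF Rs(2) s(2)] by blast
    have "R \<circ> word_map f (s # w) = (R \<circ> f s) \<circ> word_map f w" by (simp add: comp_assoc)
    also have "\<dots> = f t \<circ> (h \<circ> word_map f w)" by (simp only: Rs(1) comp_assoc)
    also have "\<dots> = word_map f (t # x) \<circ> g" by (simp only: x(4) word_map.simps comp_assoc)
    finally have Rw: "R \<circ> word_map f (s # w) = word_map f (t # x) \<circ> g" .
    \<comment> \<open>The cells of \<open>t # x\<close> and \<open>v\<close> have the same centre: each is the mirror image of that of \<open>s # w\<close>.\<close>
    have "similitude (r ^ length (s # w)) (word_map f v)"
      using similitude_word[OF Cons.prems(2)] Cons.prems(3) by simp
    then have "word_map f (s # w) (reflect_in (affine hull (edge J i)) 0) = word_map f v 0"
      using mirrored_centre[OF J sim_w] Cons.prems(4,5) by blast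
    moreover have "R (word_map f (s # w) 0)
        = word_map f (s # w) (reflect_in (affine hull (edge J i)) 0)"
      unfolding R_def by (rule reflect_in_image_edge[OF sim_w])
    moreover have "R (word_map f (s # w) 0) = word_map f (t # x) 0"
      using Rw G_fixes_0[OF x(3)] by (metis comp_apply)
    ultimately have "word_map f (t # x) 0 = word_map f v 0" by simp
    then have "t # x = v"
      using x v by (intro same_centre) auto
    then have "R \<circ> word_map f (s # w) = word_map f v \<circ> g" using Rw by simp
    then show ?thesis using x(3) unfolding R_def by blast
  qed
qed

text \<open>Once \<open>R \<circ> f\<^sub>w = f\<^sub>v \<circ> g\<close> is known, the images of pieces are those
  under \<open>g \<in> G \<subseteq> G\<^sub>*\<close>. A point of the attractor on the edge \<open>b\<^sub>i\<close> is
  mapped by \<open>f\<^sub>w\<close> to a fixed point of \<open>R\<close>, hence to a point of both pieces.\<close>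

lemma neighbours:
  assumes w: "w \<in> lists S" and v: "v \<in> lists S" and "length w = length v"
    and "cell w \<inter> cell v = word_map f w ` edge J i"
    and "word_map f w ` edge J i = word_map f v ` edge J j"
  defines "R \<equiv> reflect_in (affine hull (word_map f w ` edge J i))"
  defines "g \<equiv> Hilbert_Choice.inv (word_map f v) \<circ> R \<circ> word_map f w"
  shows "g \<in> G"
    and "\<And>u. u \<in> lists S \<Longrightarrow> R ` word_map f (w @ u) ` attractor
      = word_map f (v @ star_word J S f g u) ` attractor"
    and "word_map f w ` attractor \<inter> word_map f v ` attractor \<noteq> {}"
proof -
  obtain h where h: "h \<in> G" "R \<circ> word_map f w = word_map f v \<circ> h"
    using word_reflection[OF assms(1-5)] unfolding R_def by blast
  have "inj (word_map f v)" using similitude_inj[OF similitude_word[OF v]] .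
  then have "g = h"
    unfolding g_def comp_assoc h(2) by (simp add: fun_eq_iff)
  with h show "g \<in> G" by simp
  then have star: "g \<in> G_star J S f" using G_subset_G_star by blast
  have Rw: "R ` word_map f w ` X = word_map f v ` g ` X" for X
    using h(2) \<open>g = h\<close> by (metis image_comp)
  show reflect: "R ` word_map f (w @ u) ` attractor = word_map f (v @ star_word J S f g u) ` attractor"
    if u: "u \<in> lists S" for u
  proof -
    have "R ` word_map f (w @ u) ` attractor = R ` word_map f w ` word_map f u ` attractor"
      by (simp add: word_map_append image_comp comp_assoc)
    also have "\<dots> = word_map f v ` word_map f (star_word J S f g u) ` attractor"
      by (simp only: Rw G_star_attractor[OF star u])
    finally show ?thesis by (simp add: word_map_append image_comp)
  qed
  obtain x where x: "x \<in> attractor" "x \<in> edge J i" using attractor_meets_edge by blast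
  have "star_word J S f g [] = []"
    using star_word(2)[OF star, of "[]"] by simp
  then have "R ` word_map f w ` attractor = word_map f v ` attractor"
    using reflect[of "[]"] by simp
  moreover have "R (word_map f w x) = word_map f w x"
    unfolding R_def using x(2) by (intro reflect_in_self closed_affine_hull hull_inc imageI)
  ultimately have "word_map f w x \<in> word_map f v ` attractor"
    using x(1) by (metis imageI)
  then show "word_map f w ` attractor \<inter> word_map f v ` attractor \<noteq> {}"
    using x(1) by blast
qed

lemma connected_gon_attractor: "connected attractor"
proof (rule connected_attractor)
  let ?E = "edge_adjacency J G S f \<phi>"
  show "(s, t) \<in> (?E \<union> ?E\<inverse>)\<^sup>*" if "s \<in> S" "t \<in> S" for s t using linked that by blast
  have "s \<in> S \<and> t \<in> S \<and> f s ` attractor \<inter> f t ` attractor \<noteq> {}" if "(s, t) \<in> ?E" for s t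
  proof -
    from that obtain i j where "s \<in> S" "t \<in> S"
      "f s ` polygon J \<inter> f t ` polygon J = f s ` edge J i" "f s ` edge J i = f t ` edge J j"
      unfolding edge_adjacency_def meet_at_edge_def by blast
    then show ?thesis using neighbours(3)[of "[s]" "[t]" i j] by simp
  qed
  then show "s \<in> S \<and> t \<in> S \<and> f s ` attractor \<inter> f t ` attractor \<noteq> {}" if "(s, t) \<in> ?E \<union> ?E\<inverse>" for s t
    using that by blast
qed

end

theorem theorem2p12:
  fixes J :: nat and G :: "(real^2 \<Rightarrow> real^2) set"
    and S :: "'s set" and f :: "'s \<Rightarrow> real^2 \<Rightarrow> real^2"
    and K :: "(real^2) set"
  assumes "J \<ge> 3"
    and "subgroup G (D_group J)"
    and "ss_system J G S f"
    and "K = self_similar_set S f"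
  shows
    "(\<forall>i. K \<inter> edge J i \<noteq> {}) \<and>
     (\<forall>g\<in>G_star J S f. \<forall>w\<in>lists S.
        g ` word_map f w ` K = word_map f (star_word J S f g w) ` K) \<and>
     (\<forall>n\<ge>1. \<forall>w\<in>lists S. \<forall>v\<in>lists S. \<forall>i j.
        length w = n \<and> length v = n \<and>
        word_map f w ` polygon J \<inter> word_map f v ` polygon J = word_map f w ` edge J i \<and>
        word_map f w ` edge J i = word_map f v ` edge J j \<longrightarrow>
        word_map f w ` K \<inter> word_map f v ` K \<noteq> {} \<and>
        (let R = reflect_in (affine hull (word_map f w ` edge J i));
             g = Hilbert_Choice.inv (word_map f v) \<circ> R \<circ> word_map f w
         in g \<in> G \<and>
            (\<forall>u\<in>lists S. R ` word_map f (w @ u) ` K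
               = word_map f (v @ star_word J S f g u) ` K))) \<and>
     connected K"
proof -
  obtain r \<phi> c where "gon_system J G S f r \<phi> c"
    using ss_system_gon_system[OF assms(1,3)] .
  then interpret gon_system J G S f r \<phi> c .
  have K: "K = attractor" using assms(4) self_similar_set_attractor by simp
  show ?thesis
    unfolding K Let_def
    by (intro conjI allI ballI impI; (elim conjE)?)
      (use attractor_meets_edge G_star_attractor neighbours connected_gon_attractor in auto)
qed

end
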